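(* If $\widetilde\nabla$ is a special second-order connection on $T^{(2)}M$ induced from a (first-order) connection $\nabla$ on $M$, then every geodesic of $\nabla$ is also a (second-order) geodesic of $\widetilde\nabla$.
   Context: $M$ is a Hausdorff, paracompact, smooth manifold modelled on a finite-dimensional Banach space $\mathbf E$. For a chart $(U,\varphi)$: $f_\varphi=f\circ\varphi^{-1}$, $X_\varphi:\varphi U\to\mathbf E$ is the local representative of a vector field $X$, and $c_\varphi=\varphi\circ c$ for a curve $c$. A connection on $M$ is a Koszul connection $\nabla$ on $TM$; its Christoffel symbol $\Gamma_\varphi$ is defined by $(\nabla_XY)_\varphi=DY_\varphi\cdot X_\varphi-\Gamma_\varphi(X_\varphi,Y_\varphi)$, and a smooth curve $c$ is a geodesic of $\nabla$ iff $c_\varphi''=\Gamma_\varphi(c_\varphi',c_\varphi')$ in all charts. For $f$ smooth, $\nabla f=df$, $\nabla^2f(Y,Z)=Y\cdot Z\cdot f-(\nabla_YZ)\cdot f$, and $\nabla^3f(X,Y,Z)=X\cdot(\nabla^2f(Y,Z))-\nabla^2f(\nabla_XY,Z)-\nabla^2f(Y,\nabla_XZ)$. Second-order tangent bundle. $\mathbf E\Delta\mathbf E$ is the symmetric tensor product of $\mathbf E$ with itself, with product $y\Delta z=z\Delta y$; symmetric bilinear maps on $\mathbf E\times\mathbf E$ are identified with linear maps on $\mathbf E\Delta\mathbf E$, so $D^2F(u)\cdot(y\Delta z)=D^2F(u)(y,z)$; for linear $A$, $(A\Delta A)(y\Delta z)=Ay\Delta Az$. $T^{(2)}M$ is the vector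 bundle over $M$ with fibre $\mathbf E\oplus(\mathbf E\Delta\mathbf E)$ whose local representatives $e\oplus s$ in a chart $\varphi$ and $\bar e\oplus\bar s$ in a chart $\psi$ of the same element over $m$ are related, with $F=\psi\circ\varphi^{-1}$ and $u=\varphi m$, by $\bar e=DF(u)\cdot e+D^2F(u)\cdot s$ and $\bar s=(DF(u)\Delta DF(u))\cdot s$. Special second-order connections. A connection $\widetilde\nabla$ on $T^{(2)}M$ is a Koszul connection on this vector bundle; in a chart $(\widetilde\nabla_X\tau)_\varphi=D\tau_\varphi\cdot X_\varphi-\widetilde\Gamma_\varphi(X_\varphi,\tau_\varphi)$. It is a special second-order connection if in every chart $\widetilde\Gamma_\varphi(X_\varphi,V_\varphi\oplus S_\varphi)=R_\varphi(X_\varphi,S_\varphi)\oplus(-X_\varphi\Delta V_\varphi+C_\varphi(X_\varphi,S_\varphi))$ with $R_\varphi$ valued in $\mathbf E$, $C_\varphi$ valued in $\mathbf E\Delta\mathbf E$, both bilinear and smooth in the base point (the Christoffel symbols of $\widetilde\nabla$). One writes $R_\varphi(X,Y,Z)=R_\varphi(X,Y\Delta Z)$, $C_\varphi(X,Y,Z)=C_\varphi(X,Y\Delta Z)$. Induced connection. $\widetilde\nabla$ is induced by $\nabla$ if it is the special second-order connection associated to the third-order Hessian structure $f\mapsto\nabla^3f$, i.e. its Christoffel symbols satisfy, in every chart and for all smooth $f$ and vector fields $X,Y,Z$, $\nabla^3f(X,Y,Z)=D^3f_\varphi(X_\varphi,Y_\varphi,Z_\varphi)+D^2f_\varphi\cdot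 C_\varphi(X_\varphi,Y_\varphi,Z_\varphi)+Df_\varphi\cdot R_\varphi(X_\varphi,Y_\varphi,Z_\varphi)$. Second-order geodesics. For a smooth curve $c$ in $M$, $\ddot c$ is the section of $T^{(2)}M$ along $c$ with local representative $c_\varphi''\oplus(c_\varphi'\Delta c_\varphi')$. $c$ is a second-order geodesic of $\widetilde\nabla$ if $\widetilde\nabla_{\dot c}\ddot c=0$ for all $t$; equivalently, in every chart, $c_\varphi'''=R_\varphi(c_\varphi',c_\varphi',c_\varphi')$ and $C_\varphi(c_\varphi',c_\varphi',c_\varphi')=3\,c_\varphi'\Delta c_\varphi''$. *)

theory Defs
  imports "HOL-Analysis.Analysis"
begin

section \<open>Finite-dimensional normed spaces\<close>

definition finite_dimensional :: "'e::real_vector itself \<Rightarrow> bool" where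
  "finite_dimensional _ \<longleftrightarrow> (\<exists>B::'e set. finite B \<and> span B = UNIV)"

lemma complete_span_finite:
  fixes B :: "'e::real_normed_vector set"
  assumes "finite B"
  shows "complete (span B)"
  using assms
proof (induction B)
  case empty
  then show ?case by (simp add: compact_imp_complete)
next
  case (insert a B)
  show ?case
  proof (cases "a \<in> span B")
    case True
    then show ?thesis using insert.IH by (simp add: span_redundant)
  next
    case False
    have "closed (span B)" using insert.IH by (rule complete_imp_closed)
    then have "open (- span B)" by (rule open_Compl)
    then obtain d where d: "d > 0" "ball a d \<subseteq> - span B"
      using False by (meson ComplI open_contains_ball)
    have coef: "\<bar>k\<bar> * d \<le> norm (k *\<^sub>R a + y)" if "y \<in> span B" for k y
    proof (cases "k = 0")
      case False
      have "- (1/k) *\<^sub>R y \<in> span B" using that by (rule span_scale)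
      then have "\<not> dist a (- (1/k) *\<^sub>R y) < d" using d by (meson ComplD mem_ball subsetD)
      then have "d \<le> norm (a + (1/k) *\<^sub>R y)" by (simp add: dist_norm)
      then have "\<bar>k\<bar> * d \<le> \<bar>k\<bar> * norm (a + (1/k) *\<^sub>R y)" by (simp add: mult_left_mono)
      also have "\<dots> = norm (k *\<^sub>R (a + (1/k) *\<^sub>R y))" by simp
      also have "k *\<^sub>R (a + (1/k) *\<^sub>R y) = k *\<^sub>R a + y"
        using False by (simp add: scaleR_add_right)
      finally show ?thesis .
    qed simp
    show ?thesis
    proof (rule completeI)
      fix f assume f: "\<forall>n. f n \<in> span (insert a B)" and cau: "Cauchy f"
      have "\<forall>n. \<exists>k. f n - k *\<^sub>R a \<in> span B" using f by (auto simp: span_insert)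
      then obtain k where k: "\<And>n. f n - k n *\<^sub>R a \<in> span B" by metis
      have kd: "\<bar>k m - k n\<bar> * d \<le> norm (f m - f n)" for m n
      proof -
        have "(f m - k m *\<^sub>R a) - (f n - k n *\<^sub>R a) \<in> span B" by (rule span_diff[OF k k])
        from coef[OF this, of "k m - k n"] show ?thesis by (simp add: algebra_simps)
      qed
      have "Cauchy k"
      proof (rule CauchyI)
        fix e :: real assume "e > 0"
        then obtain M where M: "\<And>m n. m \<ge> M \<Longrightarrow> n \<ge> M \<Longrightarrow> norm (f m - f n) < e * d"
          using CauchyD[OF cau, of "e * d"] d by auto
        have "norm (k m - k n) < e" if "m \<ge> M" "n \<ge> M" for m n
        proof -
          have "\<bar>k m - k n\<bar> * d < e * d" using kd[of m n] M[OF that] by linarith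
          then show ?thesis using d by simp
        qed
        then show "\<exists>M. \<forall>m\<ge>M. \<forall>n\<ge>M. norm (k m - k n) < e" by blast
      qed
      then obtain l where l: "k \<longlonglongrightarrow> l" using real_Cauchy_convergent convergent_def by blast
      then have ka: "(\<lambda>n. k n *\<^sub>R a) \<longlonglongrightarrow> l *\<^sub>R a" by (intro tendsto_intros)
      then have kc: "Cauchy (\<lambda>n. k n *\<^sub>R a)" by (simp add: LIMSEQ_imp_Cauchy)
      have "Cauchy (\<lambda>n. f n - k n *\<^sub>R a)"
      proof (rule CauchyI)
        fix e :: real assume "e > 0"
        then have "e / 2 > 0" by simp
        obtain M where M: "\<And>m n. m \<ge> M \<Longrightarrow> n \<ge> M \<Longrightarrow> norm (f m - f n) < e / 2"
          using CauchyD[OF cau \<open>e / 2 > 0\<close>] by blast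
        obtain N where
          N: "\<And>m n. m \<ge> N \<Longrightarrow> n \<ge> N \<Longrightarrow> norm (k m *\<^sub>R a - k n *\<^sub>R a) < e / 2"
          using CauchyD[OF kc \<open>e / 2 > 0\<close>] by blast
        have "norm ((f m - k m *\<^sub>R a) - (f n - k n *\<^sub>R a)) < e"
          if "m \<ge> max M N" "n \<ge> max M N" for m n
        proof -
          have "norm ((f m - k m *\<^sub>R a) - (f n - k n *\<^sub>R a))
              = norm ((f m - f n) - (k m *\<^sub>R a - k n *\<^sub>R a))"
            by (simp add: algebra_simps)
          also have "\<dots> \<le> norm (f m - f n) + norm (k m *\<^sub>R a - k n *\<^sub>R a)"
            by (rule norm_triangle_ineq4)
          finally show ?thesis using M[of m n] N[of m n] that by simp
        qed
        then show "\<exists>M. \<forall>m\<ge>M. \<forall>n\<ge>M.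
            norm ((f m - k m *\<^sub>R a) - (f n - k n *\<^sub>R a)) < e" by blast
      qed
      from completeE[OF insert.IH allI[OF k] this]
      obtain y where y: "y \<in> span B" "(\<lambda>n. f n - k n *\<^sub>R a) \<longlonglongrightarrow> y"
        by blast
      have "f \<longlonglongrightarrow> l *\<^sub>R a + y" using tendsto_add[OF ka y(2)] by simp
      moreover have "l *\<^sub>R a + y \<in> span (insert a B)"
        using y(1) by (auto simp: span_insert intro!: exI[of _ l])
      ultimately show "\<exists>x\<in>span (insert a B). f \<longlonglongrightarrow> x" by blast
    qed
  qed
qed

lemma bounded_linear_finite_dimensional:
  fixes L :: "'e::real_normed_vector \<Rightarrow> 'f::real_normed_vector"
  assumes fd: "finite_dimensional TYPE('e)" and L: "linear L"
  shows "bounded_linear L"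
proof -
  obtain B0 :: "'e set" where B0: "finite B0" "span B0 = UNIV"
    using fd unfolding finite_dimensional_def by blast
  obtain B where B: "B \<subseteq> B0" "independent B" "span B = UNIV"
    using maximal_independent_subset[of B0] B0(2)
    by (metis span_mono span_span top.extremum_unique)
  have fin: "finite B" using B(1) B0(1) finite_subset by blast
  have coord: "bounded_linear (\<lambda>x. representation B x b)" if b: "b \<in> B" for b
  proof -
    have "closed (span (B - {b}))"
      using complete_span_finite[of "B - {b}"] fin by (simp add: complete_imp_closed)
    moreover have nb: "b \<notin> span (B - {b})" using B(2) b by (simp add: dependent_def)
    ultimately obtain d where d: "d > 0" "ball b d \<subseteq> - span (B - {b})"
      by (meson ComplI open_contains_ball open_Compl)
    show ?thesis
    proof (rule bounded_linear_intro[where K = "1/d"])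
      fix x y :: 'e and r :: real
      show "representation B (x + y) b = representation B x b + representation B y b"
        using B by (simp add: representation_add)
      show "representation B (r *\<^sub>R x) b = r *\<^sub>R representation B x b"
        using B by (simp add: representation_scale)
      let ?k = "representation B x b"
      have "x = (\<Sum>v\<in>B. representation B x v *\<^sub>R v)"
        using sum_representation_eq[of B x B] B fin by simp
      also have "\<dots> = ?k *\<^sub>R b + (\<Sum>v\<in>B - {b}. representation B x v *\<^sub>R v)"
        using fin b by (simp add: sum.remove)
      finally obtain y where y: "x = ?k *\<^sub>R b + y" "y \<in> span (B - {b})"
        by (metis (no_types, lifting) span_base span_scale span_sum)
      have "\<bar>?k\<bar> * d \<le> norm x"
      proof (cases "?k = 0")
        case False
        have "- (1/?k) *\<^sub>R y \<in> span (B - {b})" using y(2) by (rule span_scale)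
        then have "\<not> dist b (- (1/?k) *\<^sub>R y) < d" using d by (meson ComplD mem_ball subsetD)
        then have "d \<le> norm (b + (1/?k) *\<^sub>R y)" by (simp add: dist_norm)
        then have "\<bar>?k\<bar> * d \<le> \<bar>?k\<bar> * norm (b + (1/?k) *\<^sub>R y)" by (simp add: mult_left_mono)
        also have "\<dots> = norm (?k *\<^sub>R (b + (1/?k) *\<^sub>R y))" by simp
        also have "?k *\<^sub>R (b + (1/?k) *\<^sub>R y) = x"
          using False y(1) by (simp add: scaleR_add_right)
        finally show ?thesis .
      qed simp
      then show "norm ?k \<le> norm x * (1/d)" using d by (simp add: field_simps)
    qed
  qed
  have "L = (\<lambda>x. \<Sum>v\<in>B. representation B x v *\<^sub>R L v)"
  proof
    fix x
    have "x = (\<Sum>v\<in>B. representation B x v *\<^sub>R v)"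
      using sum_representation_eq[of B x B] B fin by simp
    then have "L x = L (\<Sum>v\<in>B. representation B x v *\<^sub>R v)" by simp
    also have "\<dots> = (\<Sum>v\<in>B. representation B x v *\<^sub>R L v)"
      using L by (simp add: linear_sum linear_scale)
    finally show "L x = (\<Sum>v\<in>B. representation B x v *\<^sub>R L v)" .
  qed
  moreover have "bounded_linear (\<lambda>x. \<Sum>v\<in>B. representation B x v *\<^sub>R L v)"
    by (intro bounded_linear_sum bounded_linear_compose[OF bounded_linear_scaleR_left] coord)
  ultimately show ?thesis by metis
qed


section \<open>The symmetric tensor square\<close>

text \<open>
  A symmetric tensor is realised as the functional it induces on bounded bilinear forms.
  In finite dimension all bilinear forms are bounded, and
  \<open>sym_tensor_universal\<close> below is the usual universal property.
\<close>

definition sym_eval ::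
  "'e::real_normed_vector \<Rightarrow> 'e \<Rightarrow> ('e \<Rightarrow>\<^sub>L 'e \<Rightarrow>\<^sub>L real) \<Rightarrow>\<^sub>L real" where
  "sym_eval y z = Blinfun (\<lambda>b :: 'e \<Rightarrow>\<^sub>L 'e \<Rightarrow>\<^sub>L real. (b y z + b z y) / 2)"

lemma sym_eval_apply: "blinfun_apply (sym_eval y z) b = (b y z + b z y) / 2"
  unfolding sym_eval_def
  by (subst bounded_linear_Blinfun_apply) (intro bounded_linear_compose[OF bounded_linear_divide] bounded_linear_add
      bounded_linear_compose[OF blinfun.bounded_linear_left blinfun.bounded_linear_left], simp)

typedef (overloaded) 'e sym_tensor =
  "span {sym_eval y z | y z. True} :: (('e::real_normed_vector \<Rightarrow>\<^sub>L 'e \<Rightarrow>\<^sub>L real) \<Rightarrow>\<^sub>L real) set"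
  by (rule exI[of _ 0]) (rule span_zero)

setup_lifting type_definition_sym_tensor

instantiation sym_tensor :: (real_normed_vector) real_normed_vector
begin

lift_definition zero_sym_tensor :: "'a sym_tensor" is 0 by (rule span_zero)
lift_definition plus_sym_tensor :: "'a sym_tensor \<Rightarrow> 'a sym_tensor \<Rightarrow> 'a sym_tensor"
  is "(+)" by (rule span_add)
lift_definition uminus_sym_tensor :: "'a sym_tensor \<Rightarrow> 'a sym_tensor"
  is uminus by (rule span_neg)
lift_definition minus_sym_tensor :: "'a sym_tensor \<Rightarrow> 'a sym_tensor \<Rightarrow> 'a sym_tensor"
  is "(-)" by (rule span_diff)
lift_definition scaleR_sym_tensor :: "real \<Rightarrow> 'a sym_tensor \<Rightarrow> 'a sym_tensor"
  is scaleR by (rule span_scale)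
lift_definition norm_sym_tensor :: "'a sym_tensor \<Rightarrow> real" is norm .

definition "dist_sym_tensor (s :: 'a sym_tensor) t = norm (s - t)"
definition "sgn_sym_tensor (s :: 'a sym_tensor) = scaleR (inverse (norm s)) s"
definition "(uniformity :: ('a sym_tensor \<times> 'a sym_tensor) filter)
  = (INF e\<in>{0<..}. principal {(s, t). dist s t < e})"
definition "open (S :: 'a sym_tensor set)
  = (\<forall>s\<in>S. \<forall>\<^sub>F (s', t) in uniformity. s' = s \<longrightarrow> t \<in> S)"

instance
  apply standard
  unfolding dist_sym_tensor_def sgn_sym_tensor_def uniformity_sym_tensor_def open_sym_tensor_def
  apply (rule refl | (transfer, force simp: algebra_simps norm_triangle_ineq))+
  done

end

lift_definition sym_prod :: "'e::real_normed_vector \<Rightarrow> 'e \<Rightarrow> 'e sym_tensor" (infixl \<open>\<Delta>\<close> 75)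
  is sym_eval by (rule span_base) blast

lemma sym_prod_commute: "y \<Delta> z = z \<Delta> y"
  by transfer (rule blinfun_eqI, simp add: sym_eval_apply)

lemma bilinear_sym_prod: "bilinear ((\<Delta>) :: 'e::real_normed_vector \<Rightarrow> _)"
proof -
  have "linear ((\<Delta>) (y::'e))" for y
    by (rule linearI; transfer; rule blinfun_eqI)
      (simp_all add: sym_eval_apply blinfun.bilinear_simps algebra_simps add_divide_distrib)
  then show ?thesis by (simp add: bilinear_def sym_prod_commute)
qed

lemma span_sym_prod: "span {y \<Delta> z | y z. True} = (UNIV :: 'e::real_normed_vector sym_tensor set)"
proof -
  have "\<exists>s\<in>span {y \<Delta> z | y z. True}. Rep_sym_tensor s = t"
    if "t \<in> span {sym_eval y z | y z :: 'e. True}" for t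
    using that
  proof (induction rule: span_induct_alt)
    case base
    show ?case by (rule bexI[OF _ span_zero]) (simp add: zero_sym_tensor.rep_eq)
  next
    case (step c x t)
    then obtain s y z where s: "s \<in> span {y \<Delta> z | y z. True}" "Rep_sym_tensor s = t"
      and x: "x = sym_eval y z" by blast
    have "c *\<^sub>R (y \<Delta> z) + s \<in> span {y \<Delta> z | y z. True}"
      by (intro span_add span_scale s(1) span_base) blast
    moreover have "Rep_sym_tensor (c *\<^sub>R (y \<Delta> z) + s) = c *\<^sub>R x + t"
      by (simp add: plus_sym_tensor.rep_eq scaleR_sym_tensor.rep_eq sym_prod.rep_eq s(2) x)
    ultimately show ?case by (rule bexI[rotated])
  qed
  note rep = this
  have "s \<in> span {y \<Delta> z | y z. True}" for s :: "'e sym_tensor"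
  proof -
    obtain s' where "s' \<in> span {y \<Delta> z | y z. True}" "Rep_sym_tensor s' = Rep_sym_tensor s"
      using rep[OF Rep_sym_tensor[of s]] ..
    then show ?thesis by (simp only: Rep_sym_tensor_inject)
  qed
  then show ?thesis by (intro UNIV_eq_I[symmetric])
qed

lemma sym_tensor_universal:
  fixes b :: "'e::real_normed_vector \<Rightarrow> 'e \<Rightarrow> 'f::real_vector"
  assumes fd: "finite_dimensional TYPE('e)"
    and b: "bilinear b" "\<And>y z. b y z = b z y"
  shows "\<exists>!L. linear L \<and> (\<forall>y z. L (y \<Delta> z) = b y z)"
proof (rule ex_ex1I)
  obtain B0 :: "'e set" where B0: "finite B0" "span B0 = UNIV"
    using fd unfolding finite_dimensional_def by blast
  obtain B where B: "B \<subseteq> B0" "independent B" "span B = UNIV"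
    using maximal_independent_subset[of B0] B0(2)
    by (metis span_mono span_span top.extremum_unique)
  have fin: "finite B" using B(1) B0(1) finite_subset by blast
  define r where "r v x = representation B x v" for v x
  have r: "bounded_linear (r v)" for v
    unfolding r_def using B
    by (intro bounded_linear_finite_dimensional[OF fd] linearI)
      (simp_all add: representation_add representation_scale)
  have exp: "x = (\<Sum>v\<in>B. r v x *\<^sub>R v)" for x
    unfolding r_def using sum_representation_eq[of B x B] B fin by simp
  define q where "q v w = Blinfun (\<lambda>x. r v x *\<^sub>R Blinfun (r w))" for v w
  have q: "blinfun_apply (blinfun_apply (q v w) x) y = r v x * r w y" for v w x y
    unfolding q_def
    by (subst bounded_linear_Blinfun_apply)
      (auto intro!: bounded_linear_compose[OF bounded_linear_scaleR_left] r
        simp: scaleR_blinfun.rep_eq bounded_linear_Blinfun_apply r)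
  have bexp: "b y z = (\<Sum>v\<in>B. \<Sum>w\<in>B. (r v y * r w z) *\<^sub>R b v w)" for y z
  proof -
    have "b y z = b (\<Sum>v\<in>B. r v y *\<^sub>R v) (\<Sum>w\<in>B. r w z *\<^sub>R w)"
      by (rule arg_cong2[where f = b, OF exp exp])
    also have "\<dots> = (\<Sum>(v, w)\<in>B \<times> B. b (r v y *\<^sub>R v) (r w z *\<^sub>R w))"
      using bilinear_sum[OF b(1)] by blast
    also have "\<dots> = (\<Sum>v\<in>B. \<Sum>w\<in>B. (r v y * r w z) *\<^sub>R b v w)"
      by (simp add: sum.cartesian_product bilinear_lmul[OF b(1)] bilinear_rmul[OF b(1)]
          mult.commute)
    finally show ?thesis .
  qed
  define L where "L s = (\<Sum>v\<in>B. \<Sum>w\<in>B. blinfun_apply (Rep_sym_tensor s) (q v w) *\<^sub>R b v w)" for s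
  have "linear L"
    by (rule linearI)
      (simp_all add: L_def plus_sym_tensor.rep_eq scaleR_sym_tensor.rep_eq blinfun.bilinear_simps
        scaleR_add_left sum.distrib scaleR_sum_right)
  moreover have "L (y \<Delta> z) = b y z" for y z
  proof -
    have "L (y \<Delta> z) = (\<Sum>v\<in>B. \<Sum>w\<in>B. ((r v y * r w z + r v z * r w y) / 2) *\<^sub>R b v w)"
      by (simp add: L_def sym_prod.rep_eq sym_eval_apply q)
    also have "\<dots> = (1/2) *\<^sub>R (\<Sum>v\<in>B. \<Sum>w\<in>B. (r v y * r w z) *\<^sub>R b v w)
      + (1/2) *\<^sub>R (\<Sum>v\<in>B. \<Sum>w\<in>B. (r v z * r w y) *\<^sub>R b v w)"
      by (simp add: scaleR_sum_right add_divide_distrib scaleR_add_left sum.distrib)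
    also have "\<dots> = (1/2) *\<^sub>R b y z + (1/2) *\<^sub>R b z y"
      by (simp only: bexp[symmetric])
    also have "\<dots> = b y z" by (simp add: b(2)[of z y] flip: scaleR_add_left)
    finally show ?thesis .
  qed
  ultimately show "\<exists>L. linear L \<and> (\<forall>y z. L (y \<Delta> z) = b y z)" by blast
next
  fix L L' :: "'e sym_tensor \<Rightarrow> 'f"
  assume "linear L \<and> (\<forall>y z. L (y \<Delta> z) = b y z)" "linear L' \<and> (\<forall>y z. L' (y \<Delta> z) = b y z)"
  then have "L s = L' s" if "s \<in> span {y \<Delta> z | y z. True}" for s
    using that by (auto intro: linear_eq_on_span[of L L' "{y \<Delta> z | y z. True}"])
  then show "L = L'" unfolding span_sym_prod by blast
qed

text \<open>The linear map on \<open>E \<Delta> E\<close> identified with a symmetric bilinear map \<open>b\<close>.\<close>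

definition sym_lift ::
  "('e::real_normed_vector \<Rightarrow> 'e \<Rightarrow> 'f::real_vector) \<Rightarrow> 'e sym_tensor \<Rightarrow> 'f" where
  "sym_lift b = (THE L. linear L \<and> (\<forall>y z. L (y \<Delta> z) = b y z))"

lemma sym_lift:
  fixes b :: "'e::real_normed_vector \<Rightarrow> 'e \<Rightarrow> 'f::real_vector"
  assumes "finite_dimensional TYPE('e)" "bilinear b" "\<And>y z. b y z = b z y"
  shows linear_sym_lift: "linear (sym_lift b)" and sym_lift_sym_prod: "sym_lift b (y \<Delta> z) = b y z"
  using theI'[OF sym_tensor_universal[OF assms]] unfolding sym_lift_def by blast+


section \<open>Smooth maps on open subsets of a finite-dimensional space\<close>

abbreviation D1 ::
  "('e::real_normed_vector \<Rightarrow> 'f::real_normed_vector) \<Rightarrow> 'e \<Rightarrow> 'e \<Rightarrow> 'f" where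
  "D1 f u x \<equiv> frechet_derivative f (at u) x"

definition D2 ::
  "('e::real_normed_vector \<Rightarrow> 'f::real_normed_vector) \<Rightarrow> 'e \<Rightarrow> 'e \<Rightarrow> 'e \<Rightarrow> 'f" where
  "D2 f u x y = D1 (\<lambda>v. D1 f v y) u x"

definition D3 ::
  "('e::real_normed_vector \<Rightarrow> 'f::real_normed_vector) \<Rightarrow> 'e \<Rightarrow> 'e \<Rightarrow> 'e \<Rightarrow> 'e \<Rightarrow> 'f" where
  "D3 f u x y z = D1 (\<lambda>v. D2 f v y z) u x"

text \<open>
  Differentiability classes are defined through directional derivatives \<open>u \<mapsto> Df(u)v\<close> with fixed \<open>v\<close>.
  For a finite-dimensional domain this is the usual notion of a \<open>C\<^sup>k\<close> map.
\<close>

primrec k_smooth_on ::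
  "nat \<Rightarrow> 'e::real_normed_vector set \<Rightarrow> ('e \<Rightarrow> 'f::real_normed_vector) \<Rightarrow> bool" where
  "k_smooth_on 0 S f \<longleftrightarrow> continuous_on S f"
| "k_smooth_on (Suc k) S f \<longleftrightarrow>
     (\<forall>u\<in>S. f differentiable (at u)) \<and> (\<forall>v. k_smooth_on k S (\<lambda>u. D1 f u v))"

definition smooth_on ::
  "'e::real_normed_vector set \<Rightarrow> ('e \<Rightarrow> 'f::real_normed_vector) \<Rightarrow> bool" where
  "smooth_on S f \<longleftrightarrow> (\<forall>k. k_smooth_on k S f)"

lemma smooth_on_differentiable: "smooth_on S f \<Longrightarrow> u \<in> S \<Longrightarrow> f differentiable (at u)"
  unfolding smooth_on_def by (metis k_smooth_on.simps(2))


section \<open>Smooth manifolds\<close>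

text \<open>A chart is a domain together with a map that is only relevant on this domain.\<close>

type_synonym ('m, 'e) chart = "'m set \<times> ('m \<Rightarrow> 'e)"

abbreviation dom_of :: "('m, 'e) chart \<Rightarrow> 'm set" where "dom_of \<phi> \<equiv> fst \<phi>"
abbreviation map_of_chart :: "('m, 'e) chart \<Rightarrow> 'm \<Rightarrow> 'e" where "map_of_chart \<phi> \<equiv> snd \<phi>"

definition img_of :: "('m, 'e) chart \<Rightarrow> 'e set" where
  "img_of \<phi> = map_of_chart \<phi> ` dom_of \<phi>"

definition inv_chart :: "('m, 'e) chart \<Rightarrow> 'e \<Rightarrow> 'm" where
  "inv_chart \<phi> = inv_into (dom_of \<phi>) (map_of_chart \<phi>)"

definition is_chart :: "('m::topological_space, 'e::topological_space) chart \<Rightarrow> bool" where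
  "is_chart \<phi> \<longleftrightarrow> open (dom_of \<phi>) \<and> open (img_of \<phi>) \<and>
     homeomorphism (dom_of \<phi>) (img_of \<phi>) (map_of_chart \<phi>) (inv_chart \<phi>)"

definition transition :: "('m, 'e) chart \<Rightarrow> ('m, 'e) chart \<Rightarrow> 'e \<Rightarrow> 'e" where
  "transition \<phi> \<psi> = map_of_chart \<psi> \<circ> inv_chart \<phi>"

definition compatible ::
  "('m, 'e::real_normed_vector) chart \<Rightarrow> ('m, 'e) chart \<Rightarrow> bool" where
  "compatible \<phi> \<psi> \<longleftrightarrow>
     smooth_on (map_of_chart \<phi> ` (dom_of \<phi> \<inter> dom_of \<psi>)) (transition \<phi> \<psi>) \<and>
     smooth_on (map_of_chart \<psi> ` (dom_of \<phi> \<inter> dom_of \<psi>)) (transition \<psi> \<phi>)"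

definition paracompact_type :: "'m::topological_space itself \<Rightarrow> bool" where
  "paracompact_type _ \<longleftrightarrow>
     (\<forall>\<U>::'m set set. (\<forall>U\<in>\<U>. open U) \<and> \<Union>\<U> = UNIV \<longrightarrow>
        (\<exists>\<V>. (\<forall>V\<in>\<V>. open V) \<and> \<Union>\<V> = UNIV \<and> (\<forall>V\<in>\<V>. \<exists>U\<in>\<U>. V \<subseteq> U) \<and>
             locally_finite_in euclidean \<V>))"

text \<open>
  The manifold is the whole type \<open>'m\<close>; its smooth structure is the set \<open>M\<close> of all
  charts (a maximal atlas). Hausdorffness is the sort constraint.
\<close>

definition smooth_manifold :: "('m::t2_space, 'e::banach) chart set \<Rightarrow> bool" where
  "smooth_manifold M \<longleftrightarrow>
     finite_dimensional TYPE('e) \<and> paracompact_type TYPE('m) \<and>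
     (\<forall>\<phi>\<in>M. is_chart \<phi>) \<and>
     (\<Union>\<phi>\<in>M. dom_of \<phi>) = UNIV \<and>
     (\<forall>\<phi>\<in>M. \<forall>\<psi>\<in>M. compatible \<phi> \<psi>) \<and>
     (\<forall>\<psi>. is_chart \<psi> \<and> (\<forall>\<phi>\<in>M. compatible \<phi> \<psi>) \<longrightarrow> \<psi> \<in> M)"

definition fun_rep :: "('m, 'e) chart \<Rightarrow> ('m \<Rightarrow> 'a) \<Rightarrow> 'e \<Rightarrow> 'a" where
  "fun_rep \<phi> f = f \<circ> inv_chart \<phi>"

definition smooth_functions :: "('m, 'e::real_normed_vector) chart set \<Rightarrow> ('m \<Rightarrow> real) set" where
  "smooth_functions M = {f. \<forall>\<phi>\<in>M. smooth_on (img_of \<phi>) (fun_rep \<phi> f)}"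


section \<open>Vector bundles given by their transition maps\<close>

text \<open>
  An element of the fibre over \<open>m\<close> is the family of its local representatives in all
  charts around \<open>m\<close>; it is set to \<open>0\<close> at all other indices, so that elements
  of the fibre are equal iff their local representatives are. The vector space operations of
  the fibre are pointwise. \<open>g \<phi> \<psi> m\<close> maps the representative in \<open>\<phi>\<close> of an element over \<open>m\<close> to
  the one in \<open>\<psi>\<close>.
\<close>

type_synonym ('m, 'e, 'f) cocycle = "('m, 'e) chart \<Rightarrow> ('m, 'e) chart \<Rightarrow> 'm \<Rightarrow> 'f \<Rightarrow> 'f"
type_synonym ('m, 'e, 'f) field = "'m \<Rightarrow> ('m, 'e) chart \<Rightarrow> 'f"

definition fibre ::
  "('m, 'e) chart set \<Rightarrow> ('m, 'e, 'f::zero) cocycle \<Rightarrow> 'm \<Rightarrow> (('m, 'e) chart \<Rightarrow> 'f) set" where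
  "fibre M g m =
     {v. (\<forall>\<phi>\<in>M. \<forall>\<psi>\<in>M. m \<in> dom_of \<phi> \<inter> dom_of \<psi> \<longrightarrow> v \<psi> = g \<phi> \<psi> m (v \<phi>)) \<and>
         (\<forall>\<phi>. \<not> (\<phi> \<in> M \<and> m \<in> dom_of \<phi>) \<longrightarrow> v \<phi> = 0)}"

definition field_rep :: "('m, 'e) chart \<Rightarrow> ('m, 'e, 'f) field \<Rightarrow> 'e \<Rightarrow> 'f" where
  "field_rep \<phi> \<tau> u = \<tau> (inv_chart \<phi> u) \<phi>"

definition smooth_sections ::
  "('m, 'e::real_normed_vector) chart set \<Rightarrow> ('m, 'e, 'f::real_normed_vector) cocycle
     \<Rightarrow> ('m, 'e, 'f) field set" where
  "smooth_sections M g =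
     {\<tau>. (\<forall>m. \<tau> m \<in> fibre M g m) \<and> (\<forall>\<phi>\<in>M. smooth_on (img_of \<phi>) (field_rep \<phi> \<tau>))}"

definition tangent :: "('m, 'e::real_normed_vector, 'e) cocycle" where
  "tangent \<phi> \<psi> m e = D1 (transition \<phi> \<psi>) (map_of_chart \<phi> m) e"

definition tangent2 :: "('m, 'e::real_normed_vector, 'e \<times> 'e sym_tensor) cocycle" where
  "tangent2 \<phi> \<psi> m = (\<lambda>(e, s).
     (let F = transition \<phi> \<psi>; u = map_of_chart \<phi> m
      in (D1 F u e + sym_lift (D2 F u) s, sym_lift (\<lambda>y z. D1 F u y \<Delta> D1 F u z) s)))"

abbreviation vector_fields ::
  "('m, 'e::real_normed_vector) chart set \<Rightarrow> ('m, 'e, 'e) field set" where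
  "vector_fields M \<equiv> smooth_sections M tangent"

text \<open>The function \<open>X \<cdot> f\<close>; the chart is immaterial by \<open>lie_fun_chart\<close>.\<close>

definition lie_fun ::
  "('m, 'e::real_normed_vector) chart set \<Rightarrow> ('m, 'e, 'e) field \<Rightarrow> ('m \<Rightarrow> real) \<Rightarrow> 'm \<Rightarrow> real" where
  "lie_fun M X f m =
     (let \<phi> = (SOME \<phi>. \<phi> \<in> M \<and> m \<in> dom_of \<phi>) in D1 (fun_rep \<phi> f) (map_of_chart \<phi> m) (X m \<phi>))"

lemma lie_fun_chart:
  fixes M :: "('m::t2_space, 'e::banach) chart set"
  assumes M: "smooth_manifold M" and f: "f \<in> smooth_functions M" and X: "X \<in> vector_fields M"
    and \<phi>: "\<phi> \<in> M" "m \<in> dom_of \<phi>"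
  shows "lie_fun M X f m = D1 (fun_rep \<phi> f) (map_of_chart \<phi> m) (X m \<phi>)"
proof -
  define \<psi> where "\<psi> = (SOME \<phi>. \<phi> \<in> M \<and> m \<in> dom_of \<phi>)"
  have \<psi>: "\<psi> \<in> M" "m \<in> dom_of \<psi>"
    using someI[of "\<lambda>\<phi>. \<phi> \<in> M \<and> m \<in> dom_of \<phi>" \<phi>] \<phi> by (auto simp: \<psi>_def)
  let ?u = "map_of_chart \<phi> m" and ?F = "transition \<phi> \<psi>"
  let ?S = "map_of_chart \<phi> ` (dom_of \<phi> \<inter> dom_of \<psi>)"
  have ch: "is_chart \<phi>" "is_chart \<psi>" "compatible \<phi> \<psi>"
    using M \<phi> \<psi> by (auto simp: smooth_manifold_def)
  have inv: "inv_chart \<phi> (map_of_chart \<phi> x) = x" if "x \<in> dom_of \<phi>" for x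
    using ch(1) that by (auto simp: is_chart_def homeomorphism_def)
  have inv': "inv_chart \<psi> (map_of_chart \<psi> x) = x" if "x \<in> dom_of \<psi>" for x
    using ch(2) that by (auto simp: is_chart_def homeomorphism_def)
  have uS: "?u \<in> ?S" using \<phi> \<psi> by blast
  have hom: "homeomorphism (img_of \<phi>) (dom_of \<phi>) (inv_chart \<phi>) (map_of_chart \<phi>)"
    using ch(1) by (simp add: is_chart_def homeomorphism_symD)
  have "openin (top_of_set (dom_of \<phi>)) (dom_of \<phi> \<inter> dom_of \<psi>)"
    using ch(2) by (auto simp: is_chart_def intro: openin_open_Int)
  then have "openin (top_of_set (img_of \<phi>)) ?S"
    using homeomorphism_imp_open_map[OF homeomorphism_symD[OF hom]] by blast
  then have oS: "open ?S" using ch(1) by (simp add: is_chart_def openin_open_eq)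
  have dF: "?F differentiable (at ?u)"
    using ch(3) uS smooth_on_differentiable by (fastforce simp: compatible_def)
  have Fu: "?F ?u = map_of_chart \<psi> m" using \<phi> by (simp add: transition_def inv)
  have df: "fun_rep \<psi> f differentiable (at (map_of_chart \<psi> m))"
    using f \<psi> by (intro smooth_on_differentiable[of "img_of \<psi>"])
      (auto simp: smooth_functions_def img_of_def)
  have comp: "(fun_rep \<psi> f \<circ> ?F) y = fun_rep \<phi> f y" if "y \<in> ?S" for y
    using that by (auto simp: fun_rep_def transition_def inv inv')
  have "((fun_rep \<psi> f \<circ> ?F) has_derivative
      (D1 (fun_rep \<psi> f) (?F ?u) \<circ> D1 ?F ?u)) (at ?u)"
    using dF df unfolding Fu[symmetric]
    by (intro diff_chain_at) (simp_all add: frechet_derivative_works)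
  then have der: "(fun_rep \<phi> f has_derivative
      (D1 (fun_rep \<psi> f) (?F ?u) \<circ> D1 ?F ?u)) (at ?u)"
    by (rule has_derivative_transform_within_open[OF _ oS uS]) (rule comp)
  then have "D1 (fun_rep \<phi> f) ?u (X m \<phi>) = D1 (fun_rep \<psi> f) (?F ?u) (D1 ?F ?u (X m \<phi>))"
    by (simp flip: frechet_derivative_at[OF der])
  also have "D1 ?F ?u (X m \<phi>) = X m \<psi>"
  proof -
    have "X m \<in> fibre M tangent m" using X by (simp add: smooth_sections_def)
    then have "X m \<psi> = tangent \<phi> \<psi> m (X m \<phi>)"
      using \<phi> \<psi> unfolding fibre_def by blast
    then show ?thesis by (simp only: tangent_def)
  qed
  finally show ?thesis by (simp add: lie_fun_def \<psi>_def[symmetric] Fu Let_def)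
qed


section \<open>Koszul connections and Christoffel symbols\<close>

type_synonym ('m, 'e, 'f) connection =
  "('m, 'e, 'e) field \<Rightarrow> ('m, 'e, 'f) field \<Rightarrow> ('m, 'e, 'f) field"

definition koszul_connection ::
  "('m, 'e::real_normed_vector) chart set \<Rightarrow> ('m, 'e, 'f::real_normed_vector) cocycle
     \<Rightarrow> ('m, 'e, 'f) connection \<Rightarrow> bool" where
  "koszul_connection M g N \<longleftrightarrow>
     (\<forall>X\<in>vector_fields M. \<forall>\<tau>\<in>smooth_sections M g. N X \<tau> \<in> smooth_sections M g) \<and>
     (\<forall>X\<in>vector_fields M. \<forall>Y\<in>vector_fields M. \<forall>\<tau>\<in>smooth_sections M g.
        N (\<lambda>m \<phi>. X m \<phi> + Y m \<phi>) \<tau> = (\<lambda>m \<phi>. N X \<tau> m \<phi> + N Y \<tau> m \<phi>)) \<and>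
     (\<forall>f\<in>smooth_functions M. \<forall>X\<in>vector_fields M. \<forall>\<tau>\<in>smooth_sections M g.
        N (\<lambda>m \<phi>. f m *\<^sub>R X m \<phi>) \<tau> = (\<lambda>m \<phi>. f m *\<^sub>R N X \<tau> m \<phi>)) \<and>
     (\<forall>X\<in>vector_fields M. \<forall>\<sigma>\<in>smooth_sections M g. \<forall>\<tau>\<in>smooth_sections M g.
        N X (\<lambda>m \<phi>. \<sigma> m \<phi> + \<tau> m \<phi>) = (\<lambda>m \<phi>. N X \<sigma> m \<phi> + N X \<tau> m \<phi>)) \<and>
     (\<forall>f\<in>smooth_functions M. \<forall>X\<in>vector_fields M. \<forall>\<tau>\<in>smooth_sections M g.
        N X (\<lambda>m \<phi>. f m *\<^sub>R \<tau> m \<phi>) = (\<lambda>m \<phi>. lie_fun M X f m *\<^sub>R \<tau> m \<phi> + f m *\<^sub>R N X \<tau> m \<phi>))"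

text \<open>
  \<open>christoffel M g N \<phi> u\<close> is the bilinear map \<open>\<Gamma>\<close> with
  \<open>(N X \<tau>)\<^sub>\<phi>(u) = D\<tau>\<^sub>\<phi>(u) X\<^sub>\<phi>(u) - \<Gamma>(X\<^sub>\<phi>(u), \<tau>\<^sub>\<phi>(u))\<close>; note the minus sign.
\<close>

definition christoffel ::
  "('m, 'e::real_normed_vector) chart set \<Rightarrow> ('m, 'e, 'f::real_normed_vector) cocycle
     \<Rightarrow> ('m, 'e, 'f) connection \<Rightarrow> ('m, 'e) chart \<Rightarrow> 'e \<Rightarrow> 'e \<Rightarrow> 'f \<Rightarrow> 'f" where
  "christoffel M g N \<phi> u =
     (THE \<Gamma>. bilinear \<Gamma> \<and>
        (\<forall>X\<in>vector_fields M. \<forall>\<tau>\<in>smooth_sections M g.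
           field_rep \<phi> (N X \<tau>) u =
             D1 (field_rep \<phi> \<tau>) u (field_rep \<phi> X u) - \<Gamma> (field_rep \<phi> X u) (field_rep \<phi> \<tau> u)))"

definition hess2 ::
  "('m, 'e::real_normed_vector) chart set \<Rightarrow> ('m, 'e, 'e) connection \<Rightarrow> ('m \<Rightarrow> real)
     \<Rightarrow> ('m, 'e, 'e) field \<Rightarrow> ('m, 'e, 'e) field \<Rightarrow> 'm \<Rightarrow> real" where
  "hess2 M N f Y Z m = lie_fun M Y (lie_fun M Z f) m - lie_fun M (N Y Z) f m"

definition hess3 ::
  "('m, 'e::real_normed_vector) chart set \<Rightarrow> ('m, 'e, 'e) connection \<Rightarrow> ('m \<Rightarrow> real)
     \<Rightarrow> ('m, 'e, 'e) field \<Rightarrow> ('m, 'e, 'e) field \<Rightarrow> ('m, 'e, 'e) field \<Rightarrow> 'm \<Rightarrow> real" where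
  "hess3 M N f X Y Z m =
     lie_fun M X (hess2 M N f Y Z) m - hess2 M N f (N X Y) Z m - hess2 M N f Y (N X Z) m"

text \<open>The two components of the Christoffel symbol of a connection on the second-order bundle.\<close>

definition R_symbol ::
  "('m, 'e::real_normed_vector) chart set \<Rightarrow> ('m, 'e, 'e \<times> 'e sym_tensor) connection
     \<Rightarrow> ('m, 'e) chart \<Rightarrow> 'e \<Rightarrow> 'e \<Rightarrow> 'e sym_tensor \<Rightarrow> 'e" where
  "R_symbol M N2 \<phi> u x s = fst (christoffel M tangent2 N2 \<phi> u x (0, s))"

definition C_symbol ::
  "('m, 'e::real_normed_vector) chart set \<Rightarrow> ('m, 'e, 'e \<times> 'e sym_tensor) connection
     \<Rightarrow> ('m, 'e) chart \<Rightarrow> 'e \<Rightarrow> 'e \<Rightarrow> 'e sym_tensor \<Rightarrow> 'e sym_tensor" where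
  "C_symbol M N2 \<phi> u x s = snd (christoffel M tangent2 N2 \<phi> u x (0, s))"

definition special_second_order_connection ::
  "('m, 'e::real_normed_vector) chart set \<Rightarrow> ('m, 'e, 'e \<times> 'e sym_tensor) connection \<Rightarrow> bool" where
  "special_second_order_connection M N2 \<longleftrightarrow>
     koszul_connection M tangent2 N2 \<and>
     (\<forall>\<phi>\<in>M.
        (\<forall>u\<in>img_of \<phi>. bilinear (R_symbol M N2 \<phi> u) \<and> bilinear (C_symbol M N2 \<phi> u)) \<and>
        (\<forall>x s. smooth_on (img_of \<phi>) (\<lambda>u. R_symbol M N2 \<phi> u x s) \<and>
               smooth_on (img_of \<phi>) (\<lambda>u. C_symbol M N2 \<phi> u x s)) \<and>
        (\<forall>u\<in>img_of \<phi>. \<forall>x v s. christoffel M tangent2 N2 \<phi> u x (v, s) =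
           (R_symbol M N2 \<phi> u x s, - (x \<Delta> v) + C_symbol M N2 \<phi> u x s)))"

definition induced_connection ::
  "('m, 'e::real_normed_vector) chart set \<Rightarrow> ('m, 'e, 'e) connection
     \<Rightarrow> ('m, 'e, 'e \<times> 'e sym_tensor) connection \<Rightarrow> bool" where
  "induced_connection M N N2 \<longleftrightarrow>
     special_second_order_connection M N2 \<and>
     (\<forall>\<phi>\<in>M. \<forall>f\<in>smooth_functions M.
        \<forall>X\<in>vector_fields M. \<forall>Y\<in>vector_fields M. \<forall>Z\<in>vector_fields M. \<forall>m\<in>dom_of \<phi>.
          (let u = map_of_chart \<phi> m; F = fun_rep \<phi> f; x = X m \<phi>; y = Y m \<phi>; z = Z m \<phi> in
           hess3 M N f X Y Z m =
             D3 F u x y z + sym_lift (D2 F u) (C_symbol M N2 \<phi> u x (y \<Delta> z))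
               + D1 F u (R_symbol M N2 \<phi> u x (y \<Delta> z))))"


section \<open>Geodesics\<close>

definition smooth_curve ::
  "('m::topological_space, 'e::real_normed_vector) chart set \<Rightarrow> real set \<Rightarrow> (real \<Rightarrow> 'm) \<Rightarrow> bool" where
  "smooth_curve M I c \<longleftrightarrow>
     open I \<and> is_interval I \<and> continuous_on I c \<and>
     (\<forall>\<phi>\<in>M. smooth_on {t\<in>I. c t \<in> dom_of \<phi>} (map_of_chart \<phi> \<circ> c))"

definition vel :: "('m, 'e::real_normed_vector) chart \<Rightarrow> (real \<Rightarrow> 'm) \<Rightarrow> real \<Rightarrow> 'e" where
  "vel \<phi> c t = vector_derivative (map_of_chart \<phi> \<circ> c) (at t)"

definition acc :: "('m, 'e::real_normed_vector) chart \<Rightarrow> (real \<Rightarrow> 'm) \<Rightarrow> real \<Rightarrow> 'e" where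
  "acc \<phi> c t = vector_derivative (vel \<phi> c) (at t)"

definition geodesic ::
  "('m::topological_space, 'e::real_normed_vector) chart set \<Rightarrow> ('m, 'e, 'e) connection
     \<Rightarrow> real set \<Rightarrow> (real \<Rightarrow> 'm) \<Rightarrow> bool" where
  "geodesic M N I c \<longleftrightarrow> smooth_curve M I c \<and>
     (\<forall>\<phi>\<in>M. \<forall>t\<in>I. c t \<in> dom_of \<phi> \<longrightarrow>
        acc \<phi> c t = christoffel M tangent N \<phi> (map_of_chart \<phi> (c t)) (vel \<phi> c t) (vel \<phi> c t))"

text \<open>
  The covariant derivative along \<open>c\<close> of a section \<open>\<tau>\<close> of the bundle along \<open>c\<close>, as the family of its
  local representatives.
\<close>

definition covariant_along ::
  "('m, 'e::real_normed_vector) chart set \<Rightarrow> ('m, 'e, 'f::real_normed_vector) cocycle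
     \<Rightarrow> ('m, 'e, 'f) connection \<Rightarrow> (real \<Rightarrow> 'm) \<Rightarrow> (real \<Rightarrow> ('m, 'e) chart \<Rightarrow> 'f)
     \<Rightarrow> real \<Rightarrow> ('m, 'e) chart \<Rightarrow> 'f" where
  "covariant_along M g N c \<tau> t \<phi> =
     (if \<phi> \<in> M \<and> c t \<in> dom_of \<phi>
      then vector_derivative (\<lambda>r. \<tau> r \<phi>) (at t)
             - christoffel M g N \<phi> (map_of_chart \<phi> (c t)) (vel \<phi> c t) (\<tau> t \<phi>)
      else 0)"

definition second_order_lift ::
  "('m, 'e::real_normed_vector) chart set \<Rightarrow> (real \<Rightarrow> 'm)
     \<Rightarrow> real \<Rightarrow> ('m, 'e) chart \<Rightarrow> 'e \<times> 'e sym_tensor" where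
  "second_order_lift M c t \<phi> =
     (if \<phi> \<in> M \<and> c t \<in> dom_of \<phi> then (acc \<phi> c t, vel \<phi> c t \<Delta> vel \<phi> c t) else 0)"

definition second_order_geodesic ::
  "('m::topological_space, 'e::real_normed_vector) chart set
     \<Rightarrow> ('m, 'e, 'e \<times> 'e sym_tensor) connection \<Rightarrow> real set \<Rightarrow> (real \<Rightarrow> 'm) \<Rightarrow> bool" where
  "second_order_geodesic M N2 I c \<longleftrightarrow> smooth_curve M I c \<and>
     (\<forall>t\<in>I. covariant_along M tangent2 N2 c (second_order_lift M c) t = (\<lambda>\<phi>. 0))"

end

theory Submission
  imports Defs
begin

text \<open>
  Near a point of a chart, take the vector field \<open>X\<close> that is constantly \<open>x\<close> there. Since \<open>\<nabla>\<^sub>X X\<close> is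
  \<open>- \<Gamma>(x, x)\<close>, the third covariant derivative of \<open>f\<close> is
  \<open>D\<^sup>3f(x, x, x) + 3 D\<^sup>2f(x, \<Gamma>(x, x)) + Df(D\<Gamma>(x)(x, x) + \<Gamma>(\<Gamma>(x, x), x) + \<Gamma>(x, \<Gamma>(x, x)))\<close>.
  Testing with functions that are locally polynomials of degree two gives
  \<open>C(x, x, x) = 3 x \<Delta> \<Gamma>(x, x)\<close> and identifies \<open>R(x, x, x)\<close> with the coefficient of \<open>Df\<close>.
  The derivative of \<open>\<Gamma>(c', c')\<close> along a geodesic \<open>c\<close> is then \<open>R(c', c', c')\<close>.
\<close>

section \<open>Calculus of smooth maps\<close>

text \<open>The hypotheses quantify over global smooth functions and vector fields, whereas the
  computation is local. Cutoffs supported in a chart mediate: they globalise constant fields and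
  quadratic test functions, and they yield the Christoffel symbol itself, since
  \<open>christoffel\<close> is a definite description whose existence and uniqueness must be
  derived from the Koszul axioms. The model space \<open>'e\<close> comes with a norm and a finite
  spanning set but no inner product, so coordinate functionals serve both for the cutoffs and for
  the product rules.

  Only diagonal values of C and R enter the geodesic equation, hence one constant field at a time
  suffices. The factor 3 counts how often \<Gamma> meets D^2f: once when Df(\<Gamma>(x, x)) is
  differentiated, and once for each of the two correction terms of the third Hessian. Torsion is
  allowed, so \<Gamma>(\<Gamma>(x, x), x) and \<Gamma>(x, \<Gamma>(x, x)) stay separate; they match
  the two terms in which the derivative of \<Gamma>(c', c') hits an argument. The term D^3f occurs
  on both sides and cancels without being evaluated.\<close>

definition coordinates :: "'e::real_normed_vector set \<Rightarrow> ('e \<Rightarrow> 'e \<Rightarrow> real) \<Rightarrow> bool" where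
  "coordinates B r \<longleftrightarrow> finite B \<and> (\<forall>b. bounded_linear (r b)) \<and> (\<forall>x. (\<Sum>b\<in>B. r b x *\<^sub>R b) = x)"

lemma coordinatesD:
  assumes "coordinates B r"
  shows "finite B" "bounded_linear (r b)" "(\<Sum>b\<in>B. r b x *\<^sub>R b) = x"
  using assms by (auto simp: coordinates_def)

lemma coordinates_exist:
  assumes "finite_dimensional TYPE('e::real_normed_vector)"
  shows "\<exists>(B :: 'e set) r. coordinates B r"
proof -
  obtain B0 :: "'e set" where B0: "finite B0" "span B0 = UNIV"
    using assms unfolding finite_dimensional_def by blast
  obtain B where B: "B \<subseteq> B0" "independent B" "span B = UNIV"
    using maximal_independent_subset[of B0] B0(2)
    by (metis span_mono span_span top.extremum_unique)
  have fin: "finite B" using B(1) B0(1) finite_subset by blast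
  have "bounded_linear (\<lambda>x. representation B x b)" for b
    using B by (intro bounded_linear_finite_dimensional[OF assms] linearI)
      (simp_all add: representation_add representation_scale)
  moreover have "(\<Sum>b\<in>B. representation B x b *\<^sub>R b) = x" for x
    using sum_representation_eq[of B x B] B fin by simp
  ultimately have "coordinates B (\<lambda>b x. representation B x b)"
    using fin by (simp add: coordinates_def)
  then show ?thesis by blast
qed

text \<open>This expansion is what makes \<open>k_smooth_on\<close> usable: its definition speaks of
  derivatives in fixed directions only, and a derivative in a moving direction becomes a finite sum
  of those with scalar coefficients.\<close>

lemma linear_coordinates:
  assumes "coordinates B r" "linear L"
  shows "L x = (\<Sum>b\<in>B. r b x *\<^sub>R L b)"
  by (subst coordinatesD(3)[OF assms(1), of x, symmetric])
    (simp add: linear_sum[OF assms(2)] linear_scale[OF assms(2)])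

section \<open>Closure properties of k times continuously differentiable maps\<close>

lemma D1_eq: "(f has_derivative f') (at u) \<Longrightarrow> D1 f u v = f' v"
  using frechet_derivative_at by metis

lemma k_smooth_on_imp_continuous: "k_smooth_on k S f \<Longrightarrow> continuous_on S f"
  by (cases k) (auto simp: continuous_on_eq_continuous_within
      intro: continuous_at_imp_continuous_within differentiable_imp_continuous_within)

lemma k_smooth_on_SucD: "k_smooth_on (Suc k) S f \<Longrightarrow> k_smooth_on k S f"
proof (induction k arbitrary: f)
  case 0
  then show ?case using k_smooth_on_imp_continuous k_smooth_on.simps(1) by blast
next
  case (Suc k)
  then show ?case by (metis k_smooth_on.simps(2))
qed

lemma k_smooth_on_has_derivative:
  "k_smooth_on (Suc k) S f \<Longrightarrow> u \<in> S \<Longrightarrow> (f has_derivative D1 f u) (at u)"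
  by (simp add: frechet_derivative_works)

lemma k_smooth_on_subset: "k_smooth_on k S f \<Longrightarrow> T \<subseteq> S \<Longrightarrow> k_smooth_on k T f"
  by (induction k arbitrary: f) (auto intro: continuous_on_subset)

lemma k_smooth_on_cong:
  assumes "open S" "\<And>x. x \<in> S \<Longrightarrow> f x = g x" "k_smooth_on k S f"
  shows "k_smooth_on k S g"
  using assms(2,3)
proof (induction k arbitrary: f g)
  case 0
  then show ?case using continuous_on_cong by force
next
  case (Suc k)
  have d: "(g has_derivative D1 f u) (at u)" if "u \<in> S" for u
    using k_smooth_on_has_derivative[OF Suc.prems(2) that] that
    by (rule has_derivative_transform_within_open[OF _ assms(1)]) (rule Suc.prems(1))
  have "k_smooth_on k S (\<lambda>u. D1 g u v)" for v
    by (rule Suc.IH[of "\<lambda>u. D1 f u v"]) (use D1_eq[OF d] Suc.prems in auto)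
  then show ?case using d by (auto simp: differentiable_def)
qed

text \<open>An explicitly exhibited derivative agrees with the chosen one on the open set
  \<open>S\<close>, so smoothness can be checked on the explicit formula instead of on
  \<open>frechet_derivative\<close>.\<close>

lemma k_smooth_on_SucI:
  assumes "open S" "\<And>u. u \<in> S \<Longrightarrow> (f has_derivative f' u) (at u)"
    and "\<And>v. k_smooth_on k S (\<lambda>u. f' u v)"
  shows "k_smooth_on (Suc k) S f"
proof -
  have "k_smooth_on k S (\<lambda>u. D1 f u v)" for v
    by (rule k_smooth_on_cong[OF assms(1) _ assms(3)[of v]]) (simp add: D1_eq[OF assms(2)])
  then show ?thesis using assms(2) by (auto simp: differentiable_def)
qed

lemma k_smooth_on_Un:
  assumes "open S" "open T" "k_smooth_on k S f" "k_smooth_on k T f"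
  shows "k_smooth_on k (S \<union> T) f"
  using assms(3,4)
  by (induction k arbitrary: f) (use assms in \<open>auto intro: continuous_on_open_Un\<close>)

lemma k_smooth_on_const: "k_smooth_on k S (\<lambda>_. a)"
  by (induction k arbitrary: a) (auto simp: differentiable_def D1_eq[OF has_derivative_const])

lemma k_smooth_on_linear:
  assumes "open S" "bounded_linear L" "k_smooth_on k S f"
  shows "k_smooth_on k S (\<lambda>x. L (f x))"
  using assms(3)
proof (induction k arbitrary: f)
  case 0
  then show ?case using bounded_linear.continuous_on[OF assms(2)] by simp
next
  case (Suc k)
  show ?case
    by (rule k_smooth_on_SucI[where f' = "\<lambda>u v. L (D1 f u v)"])
      (use Suc assms in \<open>auto intro: bounded_linear.has_derivative simp: frechet_derivative_works\<close>)
qed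

lemma k_smooth_on_id: "open S \<Longrightarrow> k_smooth_on k S (\<lambda>x. x)"
proof (cases k)
  case (Suc l)
  then show "open S \<Longrightarrow> ?thesis"
    by (auto intro!: k_smooth_on_SucI[where f' = "\<lambda>_ v. v"] k_smooth_on_const simp del: k_smooth_on.simps)
qed simp

lemma k_smooth_on_add:
  assumes "open S" "k_smooth_on k S f" "k_smooth_on k S g"
  shows "k_smooth_on k S (\<lambda>x. f x + g x)"
  using assms(2,3)
proof (induction k arbitrary: f g)
  case (Suc k)
  show ?case
    by (rule k_smooth_on_SucI[where f' = "\<lambda>u v. D1 f u v + D1 g u v"])
      (use Suc assms(1) in \<open>auto intro: has_derivative_add simp: frechet_derivative_works\<close>)
qed (simp add: continuous_on_add)

lemma k_smooth_on_sum:
  assumes "open S" "\<And>i. i \<in> A \<Longrightarrow> k_smooth_on k S (f i)"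
  shows "k_smooth_on k S (\<lambda>x. \<Sum>i\<in>A. f i x)"
  using assms(2)
  by (induction A rule: infinite_finite_induct) (auto intro: k_smooth_on_add k_smooth_on_const assms(1))

lemma k_smooth_on_scaleR:
  assumes "open S" "k_smooth_on k S f" "k_smooth_on k S g"
  shows "k_smooth_on k S (\<lambda>x. f x *\<^sub>R g x)"
  using assms(2,3)
proof (induction k arbitrary: f g)
  case (Suc k)
  \<comment> \<open>The product rule leaves undifferentiated factors, which have to count as maps of
    the lower class as well.\<close>
  note d = Suc.prems[THEN k_smooth_on_SucD]
  show ?case
    by (rule k_smooth_on_SucI[where f' = "\<lambda>u v. f u *\<^sub>R D1 g u v + D1 f u v *\<^sub>R g u"])
      (use Suc d assms(1) in \<open>auto intro!: k_smooth_on_add has_derivative_scaleR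
          simp: frechet_derivative_works\<close>)
qed (simp add: continuous_on_scaleR)

text \<open>In the chain rule the direction \<open>D1 g u v\<close> moves with \<open>u\<close>.
  After expansion in coordinates each summand is a scalar function times \<open>D1 f _ b\<close>
  composed with \<open>g\<close>, and the induction hypothesis applies to \<open>D1 f _ b\<close> in
  place of \<open>f\<close>.\<close>

lemma k_smooth_on_compose:
  fixes f :: "'e::real_normed_vector \<Rightarrow> 'f::real_normed_vector"
  assumes fd: "finite_dimensional TYPE('e)" and S: "open S" and T: "g ` S \<subseteq> T"
    and "k_smooth_on k T f" "k_smooth_on k S g"
  shows "k_smooth_on k S (\<lambda>x. f (g x))"
  using assms(4,5)
proof (induction k arbitrary: f)
  case 0
  then show ?case using continuous_on_compose2[OF _ _ T] by simp
next
  case (Suc k)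
  obtain B :: "'e set" and r where co: "coordinates B r"
    using coordinates_exist[OF fd] by blast
  note r = coordinatesD(2)[OF co]
  have d: "((\<lambda>x. f (g x)) has_derivative (\<lambda>v. D1 f (g u) (D1 g u v))) (at u)" if "u \<in> S" for u
    by (rule has_derivative_compose[OF k_smooth_on_has_derivative[OF Suc.prems(2) that]
          k_smooth_on_has_derivative[OF Suc.prems(1)]]) (use that T in auto)
  have e: "D1 f (g u) (D1 g u v) = (\<Sum>b\<in>B. r b (D1 g u v) *\<^sub>R D1 f (g u) b)" if "u \<in> S" for u v
  proof -
    have "linear (D1 f (g u))"
      using k_smooth_on_has_derivative[OF Suc.prems(1), of "g u"] that T has_derivative_linear by blast
    then show ?thesis by (rule linear_coordinates[OF co])
  qed
  show ?case
  proof (rule k_smooth_on_SucI[OF S])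
    show "((\<lambda>x. f (g x)) has_derivative (\<lambda>v. \<Sum>b\<in>B. r b (D1 g u v) *\<^sub>R D1 f (g u) b)) (at u)"
      if "u \<in> S" for u
      using d[OF that] e[OF that] by simp
    show "k_smooth_on k S (\<lambda>u. \<Sum>b\<in>B. r b (D1 g u v) *\<^sub>R D1 f (g u) b)" for v
      using Suc.prems k_smooth_on_SucD[OF Suc.prems(2)]
      by (intro k_smooth_on_sum k_smooth_on_scaleR k_smooth_on_linear[OF _ r] Suc.IH S) auto
  qed
qed

lemma smooth_on_k: "smooth_on S f \<Longrightarrow> k_smooth_on k S f"
  by (simp add: smooth_on_def)

lemma smooth_on_subset: "smooth_on S f \<Longrightarrow> T \<subseteq> S \<Longrightarrow> smooth_on T f"
  unfolding smooth_on_def using k_smooth_on_subset by blast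

lemma smooth_on_cong:
  "open S \<Longrightarrow> (\<And>x. x \<in> S \<Longrightarrow> f x = g x) \<Longrightarrow> smooth_on S f \<Longrightarrow> smooth_on S g"
  unfolding smooth_on_def using k_smooth_on_cong by blast

lemma smooth_on_Un:
  "open S \<Longrightarrow> open T \<Longrightarrow> smooth_on S f \<Longrightarrow> smooth_on T f \<Longrightarrow> smooth_on (S \<union> T) f"
  unfolding smooth_on_def using k_smooth_on_Un by blast

lemma smooth_on_const: "smooth_on S (\<lambda>_. a)"
  by (simp add: smooth_on_def k_smooth_on_const)

lemma smooth_on_id: "open S \<Longrightarrow> smooth_on S (\<lambda>x. x)"
  by (simp add: smooth_on_def k_smooth_on_id)

lemma smooth_on_linear:
  "open S \<Longrightarrow> bounded_linear L \<Longrightarrow> smooth_on S f \<Longrightarrow> smooth_on S (\<lambda>x. L (f x))"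
  by (simp add: smooth_on_def k_smooth_on_linear)

lemma smooth_on_add:
  "open S \<Longrightarrow> smooth_on S f \<Longrightarrow> smooth_on S g \<Longrightarrow> smooth_on S (\<lambda>x. f x + g x)"
  by (simp add: smooth_on_def k_smooth_on_add)

lemma smooth_on_sum:
  "open S \<Longrightarrow> (\<And>i. i \<in> A \<Longrightarrow> smooth_on S (f i)) \<Longrightarrow> smooth_on S (\<lambda>x. \<Sum>i\<in>A. f i x)"
  by (simp add: smooth_on_def k_smooth_on_sum)

lemma smooth_on_scaleR:
  "open S \<Longrightarrow> smooth_on S f \<Longrightarrow> smooth_on S g \<Longrightarrow> smooth_on S (\<lambda>x. f x *\<^sub>R g x)"
  by (simp add: smooth_on_def k_smooth_on_scaleR)

lemma smooth_on_mult:
  fixes f g :: "_ \<Rightarrow> real"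
  shows "open S \<Longrightarrow> smooth_on S f \<Longrightarrow> smooth_on S g \<Longrightarrow> smooth_on S (\<lambda>x. f x * g x)"
  using smooth_on_scaleR by fastforce

lemma smooth_on_diff:
  assumes "open S" "smooth_on S f" "smooth_on S g"
  shows "smooth_on S (\<lambda>x. f x - g x)"
  using smooth_on_add[OF assms(1,2) smooth_on_linear[OF assms(1) bounded_linear_minus[OF bounded_linear_ident] assms(3)]]
  by simp

lemma smooth_on_compose:
  fixes f :: "'e::real_normed_vector \<Rightarrow> 'f::real_normed_vector"
  assumes "finite_dimensional TYPE('e)" "open S" "g ` S \<subseteq> T" "smooth_on T f" "smooth_on S g"
  shows "smooth_on S (\<lambda>x. f (g x))"
  using assms by (simp add: smooth_on_def k_smooth_on_compose)

section \<open>Differentiation of smooth maps along moving directions\<close>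

lemma smooth_on_D1: "smooth_on S f \<Longrightarrow> smooth_on S (\<lambda>u. D1 f u v)"
  unfolding smooth_on_def by (metis k_smooth_on.simps(2))

lemma smooth_on_has_derivative:
  "smooth_on S f \<Longrightarrow> u \<in> S \<Longrightarrow> (f has_derivative D1 f u) (at u)"
  using smooth_on_differentiable frechet_derivative_works by blast

lemma smooth_on_linear_D1: "smooth_on S f \<Longrightarrow> u \<in> S \<Longrightarrow> linear (D1 f u)"
  using smooth_on_has_derivative has_derivative_linear by blast

lemma smooth_onI:
  assumes "open S" "\<And>u. u \<in> S \<Longrightarrow> (f has_derivative f' u) (at u)" "\<And>v. smooth_on S (\<lambda>u. f' u v)"
  shows "smooth_on S f"
proof -
  have "k_smooth_on (Suc k) S f" for k
    by (rule k_smooth_on_SucI[OF assms(1,2)]) (use assms(3) in \<open>auto simp: smooth_on_def\<close>)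
  then show ?thesis unfolding smooth_on_def using k_smooth_on_SucD by blast
qed

lemma smooth_on_D1_field:
  fixes f :: "'e::real_normed_vector \<Rightarrow> 'f::real_normed_vector"
  assumes fd: "finite_dimensional TYPE('e)" and S: "open S" and f: "smooth_on S f" and Z: "smooth_on S Z"
  shows "smooth_on S (\<lambda>w. D1 f w (Z w))"
proof -
  obtain B :: "'e set" and r where co: "coordinates B r"
    using coordinates_exist[OF fd] by blast
  note r = coordinatesD(2)[OF co]
  have eq: "(\<Sum>b\<in>B. r b (Z w) *\<^sub>R D1 f w b) = D1 f w (Z w)" if "w \<in> S" for w
    by (rule linear_coordinates[OF co smooth_on_linear_D1[OF f that], symmetric])
  show ?thesis
    by (rule smooth_on_cong[OF S], erule eq)
      (intro smooth_on_sum smooth_on_scaleR smooth_on_linear[OF S r Z] smooth_on_D1[OF f] S)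
qed

text \<open>The slot \<open>y\<close> is the direction of the outer derivative and is linear for
  that reason. Linearity in the remaining slot is inherited from that of \<open>D1 f w\<close> for
  all \<open>w\<close> near \<open>u\<close>.\<close>

lemma D2_linear:
  assumes "open S" "smooth_on S f" "u \<in> S"
  shows "linear (D2 f u y)"
proof (rule linearI)
  note d = smooth_on_has_derivative[OF smooth_on_D1[OF assms(2)] assms(3)]
  have c: "((\<lambda>w. D1 f w a) has_derivative g) (at u)"
    if "(h has_derivative g) (at u)" "\<And>w. w \<in> S \<Longrightarrow> h w = D1 f w a" for h g a
    by (rule has_derivative_transform_within_open[OF that(1) assms(1,3) that(2)])
  show "D2 f u y (a + b) = D2 f u y a + D2 f u y b" for a b
    unfolding D2_def
    by (rule D1_eq[OF c[OF has_derivative_add[OF d[of a] d[of b]]]]) (simp add: linear_add[OF smooth_on_linear_D1[OF assms(2)]])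
  show "D2 f u y (k *\<^sub>R a) = k *\<^sub>R D2 f u y a" for k a
    unfolding D2_def
    by (rule D1_eq[OF c[OF has_derivative_scaleR_right[OF d[of a], of k]]]) (simp add: linear_scale[OF smooth_on_linear_D1[OF assms(2)]])
qed

text \<open>The product rule for Df(w) applied to Z(w). Coordinates turn it into a finite sum of
  products of a scalar function with a fixed-direction derivative.\<close>

lemma D1_field_has_derivative:
  fixes f :: "'e::real_normed_vector \<Rightarrow> 'f::real_normed_vector"
  assumes fd: "finite_dimensional TYPE('e)" and S: "open S" "u \<in> S" and f: "smooth_on S f"
    and Z: "(Z has_derivative Z') (at u)"
  shows "((\<lambda>w. D1 f w (Z w)) has_derivative (\<lambda>y. D2 f u y (Z u) + D1 f u (Z' y))) (at u)"
proof -
  obtain B :: "'e set" and r where co: "coordinates B r"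
    using coordinates_exist[OF fd] by blast
  note r = coordinatesD(2)[OF co]
  note ex = linear_coordinates[OF co]
  have "((\<lambda>w. \<Sum>b\<in>B. r b (Z w) *\<^sub>R D1 f w b) has_derivative
      (\<lambda>y. \<Sum>b\<in>B. r b (Z u) *\<^sub>R D2 f u y b + r b (Z' y) *\<^sub>R D1 f u b)) (at u)"
    unfolding D2_def
    using smooth_on_has_derivative[OF smooth_on_D1[OF f] S(2)] bounded_linear.has_derivative[OF r Z]
    by (intro has_derivative_sum has_derivative_scaleR) auto
  also have "(\<lambda>y. \<Sum>b\<in>B. r b (Z u) *\<^sub>R D2 f u y b + r b (Z' y) *\<^sub>R D1 f u b) =
      (\<lambda>y. D2 f u y (Z u) + D1 f u (Z' y))"
    by (simp add: sum.distrib ex[OF D2_linear[OF S(1) f S(2)], of _ "Z u"]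
        ex[OF smooth_on_linear_D1[OF f S(2)], of "Z' y" for y])
  finally show ?thesis
    by (rule has_derivative_transform_within_open[OF _ S])
      (rule ex[OF smooth_on_linear_D1[OF f], symmetric])
qed

section \<open>Bump functions\<close>

text \<open>For \<open>n = 0\<close> this is the classical function exp(-1/t), extended by zero. The
  powers of 1/t are carried along so that derivatives are again linear combinations of members of
  the family, which lets smoothness be proved by induction with \<open>n\<close>
  generalised.\<close>

definition flat :: "nat \<Rightarrow> real \<Rightarrow> real" where
  "flat n t = (if t > 0 then inverse t ^ n * exp (- inverse t) else 0)"

lemma flat_tendsto_0: "(flat n \<longlongrightarrow> 0) (at 0)"
proof -
  have "((\<lambda>t. inverse t ^ n / exp (inverse t)) \<longlongrightarrow> 0) (at_right (0::real))"
    by (rule filterlim_compose[OF tendsto_power_div_exp_0 filterlim_inverse_at_top_right])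
  then have "(flat n \<longlongrightarrow> 0) (at_right 0)"
    by (rule Lim_transform_eventually)
      (auto simp: flat_def eventually_at_right_less exp_minus field_simps
        intro!: eventually_mono[OF eventually_at_right_less])
  moreover have "(flat n \<longlongrightarrow> 0) (at_left 0)"
    by (rule Lim_transform_eventually[OF tendsto_const])
      (auto simp: flat_def eventually_at_left_field intro!: exI[of _ "-1"])
  ultimately show ?thesis by (simp add: filterlim_at_split)
qed

lemma flat_deriv: "(flat n has_field_derivative flat (n + 2) t - real n * flat (n + 1) t) (at t)"
proof -
  consider "t > 0" | "t < 0" | "t = 0" by linarith
  then show ?thesis
  proof cases
    case 1
    have "((\<lambda>t. inverse t ^ n) has_field_derivative - (real n * inverse t ^ (n + 1))) (at t)"
      using DERIV_power[OF DERIV_inverse[of t], of n] 1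
      by (cases n) (simp_all add: algebra_simps)
    moreover have "((\<lambda>t. exp (- inverse t)) has_field_derivative exp (- inverse t) * inverse t ^ 2) (at t)"
      using 1 by (auto intro!: derivative_eq_intros simp: power2_eq_square)
    ultimately have "((\<lambda>t. inverse t ^ n * exp (- inverse t)) has_field_derivative
        flat (n + 2) t - real n * flat (n + 1) t) (at t)"
      using 1 by (auto dest: DERIV_mult simp: flat_def algebra_simps power2_eq_square)
    then show ?thesis
      by (rule has_field_derivative_transform_within_open[of _ _ _ "{0<..}"])
        (use 1 in \<open>auto simp: flat_def\<close>)
  next
    case 2
    have "((\<lambda>_. 0) has_field_derivative flat (n + 2) t - real n * flat (n + 1) t) (at t)"
      using 2 by (simp add: flat_def)
    then show ?thesis
      by (rule has_field_derivative_transform_within_open[of _ _ _ "{..<0}"])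
        (use 2 in \<open>auto simp: flat_def\<close>)
  next
    case 3
    \<comment> \<open>At the origin the difference quotient is the next member of the family, so the
      limit is already known.\<close>
    have "((\<lambda>h. flat n h / h) \<longlongrightarrow> 0) (at 0)"
    proof (rule Lim_transform_eventually[OF flat_tendsto_0])
      show "\<forall>\<^sub>F h in at 0. flat (n + 1) h = flat n h / h"
        by (simp add: flat_def field_simps)
    qed
    then show ?thesis using 3 by (simp add: DERIV_def flat_def)
  qed
qed

lemma smooth_on_flat: "smooth_on UNIV (flat n)"
proof -
  have "k_smooth_on k UNIV (flat n)" for k
  proof (induction k arbitrary: n)
    case 0
    show ?case by (auto intro!: DERIV_continuous_on DERIV_subset[OF flat_deriv])
  next
    case (Suc k)
    have l: "bounded_linear (\<lambda>x::real. x * v)" for v by (rule bounded_linear_mult_left)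
    \<comment> \<open>Both summands are thereby images of members of the family under multiplication
      by a constant, as the induction hypothesis requires.\<close>
    have e: "flat (n + 2) u * v + flat (n + 1) u * (- real n * v) =
        (flat (n + 2) u - real n * flat (n + 1) u) * v" for u v
      by (simp add: algebra_simps)
    show ?case
    proof (rule k_smooth_on_SucI[where f' = "\<lambda>u v. flat (n + 2) u * v + flat (n + 1) u * (- real n * v)"])
      show "(flat n has_derivative
          (\<lambda>v. flat (n + 2) u * v + flat (n + 1) u * (- real n * v))) (at u)" for u
        using flat_deriv[of n u] unfolding e has_field_derivative_def .
      show "k_smooth_on k UNIV
          (\<lambda>u. flat (n + 2) u * v + flat (n + 1) u * (- real n * v))" for v
        by (intro k_smooth_on_add k_smooth_on_linear[OF _ l] Suc.IH open_UNIV)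
    qed simp
  qed
  then show ?thesis by (simp add: smooth_on_def)
qed

lemma finite_dimensional_real: "finite_dimensional TYPE(real)"
proof -
  have "span {1::real} = UNIV" by (auto simp: span_singleton intro: rangeI[of _ "_::real"])
  then show ?thesis unfolding finite_dimensional_def by (intro exI[of _ "{1}"]) simp
qed

text \<open>Composing \<^term>\<open>flat 0\<close> with itself yields a cutoff without dividing by a positive function.\<close>

lemma smooth_step_exists:
  "\<exists>h :: real \<Rightarrow> real. smooth_on UNIV h \<and> (\<forall>t\<le>0. h t = 1) \<and> (\<forall>t\<ge>1. h t = 0)"
proof -
  \<comment> \<open>For t \<le> 0 the outer argument is \<open>flat 0 1\<close>, and the constant
    factor normalises the value to 1. For t \<ge> 1 monotonicity of exp(-1/t) makes the outer
    argument nonpositive, where \<open>flat 0\<close> vanishes.\<close>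
  define h where "h t = inverse (flat 0 (flat 0 1)) * flat 0 (flat 0 1 - flat 0 t)" for t
  have pos: "flat 0 t > 0" if "t > 0" for t using that by (simp add: flat_def)
  have "smooth_on UNIV (\<lambda>t. flat 0 (flat 0 1 - flat 0 t))"
    by (rule smooth_on_compose[OF finite_dimensional_real open_UNIV subset_UNIV smooth_on_flat])
      (intro smooth_on_diff smooth_on_const smooth_on_flat open_UNIV)
  then have "smooth_on UNIV h"
    unfolding h_def by (intro smooth_on_mult smooth_on_const open_UNIV)
  moreover have "h t = 1" if "t \<le> 0" for t
    using that pos[OF pos[of 1]] by (simp add: h_def flat_def[of 0 t])
  moreover have "h t = 0" if "t \<ge> 1" for t
  proof -
    have "inverse t \<le> 1" using that by (simp add: inverse_le_1_iff)
    then have "flat 0 1 \<le> flat 0 t" using that by (simp add: flat_def)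
    then show ?thesis by (simp add: h_def flat_def[of 0 "flat 0 1 - flat 0 t"])
  qed
  ultimately show ?thesis by blast
qed

text \<open>The box is the Minkowski sum of a compact segment and a box with one vector less. This
  supplies the compact supports of the cutoffs directly from compact real intervals.\<close>

lemma compact_box:
  fixes B :: "'e::real_normed_vector set"
  assumes "finite B"
  shows "compact {\<Sum>b\<in>B. a b *\<^sub>R b | a. \<forall>b\<in>B. \<bar>a b\<bar> \<le> d}"
  using assms
proof (induction B)
  case empty
  then show ?case by simp
next
  case (insert c B)
  let ?S = "(\<lambda>t. t *\<^sub>R c) ` {-d..d}"
  let ?T = "{\<Sum>b\<in>B. a b *\<^sub>R b | a. \<forall>b\<in>B. \<bar>a b\<bar> \<le> d}"
  have "{\<Sum>b\<in>insert c B. a b *\<^sub>R b | a. \<forall>b\<in>insert c B. \<bar>a b\<bar> \<le> d} = {x + y | x y. x \<in> ?S \<and> y \<in> ?T}"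
    (is "?L = ?R")
  proof
    show "?L \<subseteq> ?R"
    proof
      fix z assume "z \<in> ?L"
      then obtain a where a: "z = (\<Sum>b\<in>insert c B. a b *\<^sub>R b)" "\<forall>b\<in>insert c B. \<bar>a b\<bar> \<le> d" by blast
      have "z = a c *\<^sub>R c + (\<Sum>b\<in>B. a b *\<^sub>R b)" using a insert by simp
      moreover have "a c *\<^sub>R c \<in> ?S" using a(2) by (auto simp: abs_le_iff)
      moreover have "(\<Sum>b\<in>B. a b *\<^sub>R b) \<in> ?T" using a(2) by blast
      ultimately show "z \<in> ?R" by blast
    qed
    show "?R \<subseteq> ?L"
    proof
      fix z assume "z \<in> ?R"
      then obtain t a where z: "z = t *\<^sub>R c + (\<Sum>b\<in>B. a b *\<^sub>R b)" "\<bar>t\<bar> \<le> d" "\<forall>b\<in>B. \<bar>a b\<bar> \<le> d"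
        by (auto simp: abs_le_iff)
      have "(\<Sum>b\<in>B. (a(c := t)) b *\<^sub>R b) = (\<Sum>b\<in>B. a b *\<^sub>R b)"
        using insert by (intro sum.cong) auto
      then have "z = (\<Sum>b\<in>insert c B. (a(c := t)) b *\<^sub>R b)" using insert z by simp
      then show "z \<in> ?L" using z by (intro CollectI exI[of _ "a(c := t)"]) auto
    qed
  qed
  moreover have "compact ?R"
    using insert.IH by (intro compact_sums compact_continuous_image continuous_intros compact_Icc)
  ultimately show ?case by simp
qed

lemma bump_exists:
  fixes u :: "'e::real_normed_vector"
  assumes fd: "finite_dimensional TYPE('e)" and S: "open S" "u \<in> S"
  shows "\<exists>(\<beta> :: 'e \<Rightarrow> real) K W. smooth_on UNIV \<beta> \<and> compact K \<and> K \<subseteq> S \<and> (\<forall>x. x \<notin> K \<longrightarrow> \<beta> x = 0) \<and>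
    open W \<and> u \<in> W \<and> W \<subseteq> S \<and> (\<forall>x\<in>W. \<beta> x = 1)"
proof -
  obtain B :: "'e set" and r where co: "coordinates B r"
    using coordinates_exist[OF fd] by blast
  note fin = coordinatesD(1)[OF co] and r = coordinatesD(2)[OF co] and rep = coordinatesD(3)[OF co]
  obtain e where e: "e > 0" "ball u e \<subseteq> S" using S open_contains_ball by blast
  \<comment> \<open>The summand 1 makes \<open>s\<close> positive even if \<open>B\<close> is empty,
    and makes the norm bound on \<open>K\<close> below strict.\<close>
  define s where "s = (\<Sum>b\<in>B. norm b) + 1"
  have s: "s > 0" unfolding s_def by (rule add_nonneg_pos) (auto intro: sum_nonneg)
  define d where "d = e / s"
  have d: "d > 0" using e s by (simp add: d_def)
  define K where "K = (+) u ` {\<Sum>b\<in>B. a b *\<^sub>R b | a. \<forall>b\<in>B. \<bar>a b\<bar> \<le> d}"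
  have K: "compact K" unfolding K_def by (rule compact_translation[OF compact_box[OF fin]])
  have KS: "K \<subseteq> S"
  proof
    fix x assume "x \<in> K"
    then obtain a where a: "x = u + (\<Sum>b\<in>B. a b *\<^sub>R b)" "\<forall>b\<in>B. \<bar>a b\<bar> \<le> d" unfolding K_def by blast
    have "norm (\<Sum>b\<in>B. a b *\<^sub>R b) \<le> (\<Sum>b\<in>B. d * norm b)"
      by (rule sum_norm_le) (use a(2) in \<open>simp add: mult_right_mono\<close>)
    also have "\<dots> = d * (s - 1)" by (simp add: s_def sum_distrib_left)
    also have "\<dots> < d * s" using d by (simp add: algebra_simps)
    also have "d * s = e" using s by (simp add: d_def)
    finally have "x \<in> ball u e" by (simp add: a(1) dist_norm)
    then show "x \<in> S" using e by blast
  qed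
  \<comment> \<open>A smooth substitute for the squared distance from \<open>u\<close>, which the
    given norm need not provide. If it is below \<open>d * d\<close>, every coordinate is bounded by
    \<open>d\<close>, so the point lies in the box \<open>K\<close>.\<close>
  define q where "q x = (\<Sum>b\<in>B. r b (x - u) * r b (x - u))" for x
  have q: "smooth_on UNIV q"
    unfolding q_def
    by (intro smooth_on_sum smooth_on_mult smooth_on_linear[OF _ r] smooth_on_diff
        smooth_on_id smooth_on_const open_UNIV)
  have qK: "q x \<ge> d * d" if "x \<notin> K" for x
  proof (rule ccontr)
    assume lt: "\<not> q x \<ge> d * d"
    have "\<bar>r b (x - u)\<bar> \<le> d" if "b \<in> B" for b
    proof -
      have "r b (x - u) * r b (x - u) \<le> q x"
        unfolding q_def by (rule member_le_sum[OF that _ fin]) simp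
      then have "(r b (x - u))\<^sup>2 \<le> d\<^sup>2" using lt by (simp add: power2_eq_square)
      then show ?thesis using d by (simp add: abs_le_square_iff[symmetric])
    qed
    then have "x \<in> K"
      unfolding K_def using rep[of "x - u"]
      by (intro image_eqI[of _ _ "x - u"] CollectI exI[of _ "\<lambda>b. r b (x - u)"]) auto
    then show False using that by blast
  qed
  obtain h :: "real \<Rightarrow> real" where h: "smooth_on UNIV h" "\<forall>t\<le>0. h t = 1" "\<forall>t\<ge>1. h t = 0"
    using smooth_step_exists by blast
  \<comment> \<open>The argument of \<open>h\<close> is chosen to be nonpositive for q \<le> d * d /
    2 and at least 1 for q \<ge> d * d. The first range gives the neighbourhood \<open>W\<close>,
    the second contains the complement of \<open>K\<close>.\<close>
  define \<beta> where "\<beta> x = h (2 / (d * d) * q x - 1)" for x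
  define W where "W = {x. q x < d * d / 2}"
  have "smooth_on UNIV \<beta>"
    unfolding \<beta>_def
    by (rule smooth_on_compose[OF finite_dimensional_real open_UNIV subset_UNIV h(1)])
      (intro smooth_on_diff smooth_on_mult smooth_on_const q open_UNIV)
  moreover have b0: "\<beta> x = 0" if "x \<notin> K" for x
    using qK[OF that] h(3) d by (simp add: \<beta>_def field_simps)
  moreover have "open W"
    unfolding W_def
    by (rule open_Collect_less) (use k_smooth_on_imp_continuous[OF smooth_on_k[OF q]] in auto)
  moreover have "u \<in> W" using d linear_0[OF bounded_linear.linear[OF r]] by (simp add: W_def q_def)
  moreover have b1: "\<beta> x = 1" if "x \<in> W" for x
    using that h(2) d by (simp add: \<beta>_def W_def field_simps)
  moreover have "W \<subseteq> S" using b0 b1 KS by (metis subset_iff zero_neq_one)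
  ultimately show ?thesis using K KS by blast
qed

section \<open>Charts, functions and vector fields\<close>

locale manifold =
  fixes M :: "('m::t2_space, 'e::banach) chart set"
  assumes smooth_manifold: "smooth_manifold M"
begin

abbreviation overlap :: "('m, 'e) chart \<Rightarrow> ('m, 'e) chart \<Rightarrow> 'e set" where
  "overlap \<phi> \<psi> \<equiv> map_of_chart \<phi> ` (dom_of \<phi> \<inter> dom_of \<psi>)"

section \<open>Charts, transition maps and the tangent cocycle\<close>

lemma fin_dim: "finite_dimensional TYPE('e)"
  using smooth_manifold by (simp add: smooth_manifold_def)

lemma chart:
  assumes "\<phi> \<in> M"
  shows open_dom: "open (dom_of \<phi>)" and open_img: "open (img_of \<phi>)"
    and chart_homeomorphism: "homeomorphism (dom_of \<phi>) (img_of \<phi>) (map_of_chart \<phi>) (inv_chart \<phi>)"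
  using smooth_manifold assms by (auto simp: smooth_manifold_def is_chart_def)

lemma inv_chart_map: "\<phi> \<in> M \<Longrightarrow> m \<in> dom_of \<phi> \<Longrightarrow> inv_chart \<phi> (map_of_chart \<phi> m) = m"
  using chart_homeomorphism by (auto simp: homeomorphism_def)

lemma map_inv_chart: "\<phi> \<in> M \<Longrightarrow> w \<in> img_of \<phi> \<Longrightarrow> map_of_chart \<phi> (inv_chart \<phi> w) = w"
  using chart_homeomorphism by (auto simp: homeomorphism_def)

lemma inv_chart_dom: "\<phi> \<in> M \<Longrightarrow> w \<in> img_of \<phi> \<Longrightarrow> inv_chart \<phi> w \<in> dom_of \<phi>"
  using chart_homeomorphism[of \<phi>] by (auto simp: homeomorphism_def)

lemma map_img: "m \<in> dom_of \<phi> \<Longrightarrow> map_of_chart \<phi> m \<in> img_of \<phi>"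
  by (simp add: img_of_def)

lemma open_chart_image:
  assumes "\<phi> \<in> M" "open U" "U \<subseteq> dom_of \<phi>"
  shows "open (map_of_chart \<phi> ` U)"
proof -
  have "openin (top_of_set (dom_of \<phi>)) U" using assms by (simp add: open_openin_trans openin_open_eq open_dom)
  then have "openin (top_of_set (img_of \<phi>)) (map_of_chart \<phi> ` U)"
    using homeomorphism_imp_open_map[OF chart_homeomorphism[OF assms(1)]] by blast
  then show ?thesis using open_img[OF assms(1)] by (simp add: openin_open_eq)
qed

lemma open_overlap: "\<phi> \<in> M \<Longrightarrow> \<psi> \<in> M \<Longrightarrow> open (overlap \<phi> \<psi>)"
  by (intro open_chart_image open_Int open_dom) auto

lemma transition_map:
  "\<phi> \<in> M \<Longrightarrow> m \<in> dom_of \<phi> \<Longrightarrow> transition \<phi> \<psi> (map_of_chart \<phi> m) = map_of_chart \<psi> m"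
  by (simp add: transition_def inv_chart_map)

lemma smooth_transition:
  assumes "\<phi> \<in> M" "\<psi> \<in> M"
  shows "smooth_on (overlap \<phi> \<psi>) (transition \<phi> \<psi>)"
proof -
  have "compatible \<phi> \<psi>" using smooth_manifold assms by (auto simp: smooth_manifold_def)
  then show ?thesis by (simp add: compatible_def)
qed

lemma transition_has_derivative:
  assumes "\<phi> \<in> M" "\<psi> \<in> M" "m \<in> dom_of \<phi>" "m \<in> dom_of \<psi>"
  shows "(transition \<phi> \<psi> has_derivative tangent \<phi> \<psi> m) (at (map_of_chart \<phi> m))"
  unfolding tangent_def
  by (rule smooth_on_has_derivative[OF smooth_transition[OF assms(1,2)]]) (use assms in auto)

lemma linear_tangent:
  assumes "\<phi> \<in> M" "\<psi> \<in> M" "m \<in> dom_of \<phi>" "m \<in> dom_of \<psi>"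
  shows "linear (tangent \<phi> \<psi> m)"
  by (rule has_derivative_linear[OF transition_has_derivative[OF assms]])

lemma tangent_cocycle:
  assumes M: "\<phi> \<in> M" "\<psi> \<in> M" "\<theta> \<in> M" and m: "m \<in> dom_of \<phi>" "m \<in> dom_of \<psi>" "m \<in> dom_of \<theta>"
  shows "tangent \<psi> \<theta> m (tangent \<phi> \<psi> m x) = tangent \<phi> \<theta> m x"
proof -
  have "((\<lambda>w. transition \<psi> \<theta> (transition \<phi> \<psi> w)) has_derivative
      (\<lambda>x. tangent \<psi> \<theta> m (tangent \<phi> \<psi> m x))) (at (map_of_chart \<phi> m))"
    by (rule has_derivative_compose[OF transition_has_derivative])
      (use assms transition_has_derivative in \<open>auto simp: transition_map\<close>)
  then have "(transition \<phi> \<theta> has_derivative (\<lambda>x. tangent \<psi> \<theta> m (tangent \<phi> \<psi> m x)))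
      (at (map_of_chart \<phi> m))"
    \<comment> \<open>The two maps agree on the whole overlap of \<phi> and \<psi>: chart maps are
      total functions, so membership in the domain of \<theta> plays no part in this
      equation.\<close>
    by (rule has_derivative_transform_within_open[OF _ open_overlap[OF M(1,2)]])
      (use assms in \<open>auto simp: transition_map\<close>)
  from D1_eq[OF this] show ?thesis by (simp add: tangent_def)
qed

lemma tangent_refl:
  assumes "\<phi> \<in> M" "m \<in> dom_of \<phi>"
  shows "tangent \<phi> \<phi> m x = x"
proof -
  have "((\<lambda>w. w) has_derivative (\<lambda>x. x)) (at (map_of_chart \<phi> m))" by (rule has_derivative_ident)
  then have "(transition \<phi> \<phi> has_derivative (\<lambda>x. x)) (at (map_of_chart \<phi> m))"
    by (rule has_derivative_transform_within_open[OF _ open_img[OF assms(1)]])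
      (use assms in \<open>auto simp: transition_def map_inv_chart map_img\<close>)
  from D1_eq[OF this] show ?thesis by (simp add: tangent_def)
qed

text \<open>In any chart \<psi> the image is covered by two open pieces. On the overlap with \<phi>
  the function is \<open>g\<close> after a transition map; off the image of \<open>K\<close> it is
  zero. Values are real numbers for functions, and representatives in \<psi> for vector
  fields.\<close>

lemma smooth_on_extend_zero:
  assumes M: "\<phi> \<in> M" "\<psi> \<in> M" and K: "compact K" "K \<subseteq> img_of \<phi>"
    and g: "smooth_on (overlap \<phi> \<psi>) g"
    and hg: "\<And>m. m \<in> dom_of \<phi> \<Longrightarrow> m \<in> dom_of \<psi> \<Longrightarrow> h m = g (map_of_chart \<phi> m)"
    and h0: "\<And>m. m \<in> dom_of \<psi> \<Longrightarrow> m \<notin> inv_chart \<phi> ` K \<Longrightarrow> h m = 0"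
  shows "smooth_on (img_of \<psi>) (\<lambda>w. h (inv_chart \<psi> w))"
proof -
  have "continuous_on K (inv_chart \<phi>)"
    using chart_homeomorphism[OF M(1)] K(2) continuous_on_subset by (auto simp: homeomorphism_def)
  \<comment> \<open>Hausdorffness enters here: a compact set inside one chart is closed in all of
    the manifold.\<close>
  then have "closed (inv_chart \<phi> ` K)" using K(1) by (intro compact_imp_closed compact_continuous_image)
  then have U: "open (dom_of \<psi> - inv_chart \<phi> ` K)" using open_dom[OF M(2)] by (rule open_Diff[rotated])
  let ?U = "map_of_chart \<psi> ` (dom_of \<psi> - inv_chart \<phi> ` K)"
  have oU: "open ?U" by (rule open_chart_image[OF M(2) U]) auto
  have "inv_chart \<phi> ` K \<subseteq> dom_of \<phi>" using K(2) inv_chart_dom[OF M(1)] by blast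
  then have "dom_of \<psi> = (dom_of \<psi> \<inter> dom_of \<phi>) \<union> (dom_of \<psi> - inv_chart \<phi> ` K)" by blast
  then have "img_of \<psi> = overlap \<psi> \<phi> \<union> ?U" unfolding img_of_def image_Un[symmetric] by simp
  moreover have "smooth_on (overlap \<psi> \<phi>) (\<lambda>w. h (inv_chart \<psi> w))"
  proof (rule smooth_on_cong[OF open_overlap[OF M(2,1)]])
    show "g (transition \<psi> \<phi> w) = h (inv_chart \<psi> w)" if "w \<in> overlap \<psi> \<phi>" for w
      using that M by (auto simp: transition_map inv_chart_map hg)
    show "smooth_on (overlap \<psi> \<phi>) (\<lambda>w. g (transition \<psi> \<phi> w))"
      by (rule smooth_on_compose[OF fin_dim open_overlap[OF M(2,1)] _ g smooth_transition[OF M(2,1)]])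
        (use M in \<open>auto simp: transition_map\<close>)
  qed
  moreover have "smooth_on ?U (\<lambda>w. h (inv_chart \<psi> w))"
    by (rule smooth_on_cong[OF oU _ smooth_on_const[of _ 0]])
      (use M h0 in \<open>auto simp: inv_chart_map\<close>)
  ultimately show ?thesis using smooth_on_Un[OF open_overlap[OF M(2,1)] oU] by simp
qed

section \<open>Smooth functions and vector fields in local representation\<close>

lemma field_rep_map: "\<phi> \<in> M \<Longrightarrow> m \<in> dom_of \<phi> \<Longrightarrow> field_rep \<phi> X (map_of_chart \<phi> m) = X m \<phi>"
  by (simp add: field_rep_def inv_chart_map)

lemma smooth_fun_rep: "f \<in> smooth_functions M \<Longrightarrow> \<phi> \<in> M \<Longrightarrow> smooth_on (img_of \<phi>) (fun_rep \<phi> f)"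
  by (simp add: smooth_functions_def)

lemma smooth_field_rep: "X \<in> vector_fields M \<Longrightarrow> \<phi> \<in> M \<Longrightarrow> smooth_on (img_of \<phi>) (field_rep \<phi> X)"
  by (simp add: smooth_sections_def)

lemma vector_field_tangent:
  assumes "X \<in> vector_fields M" "\<phi> \<in> M" "\<psi> \<in> M" "m \<in> dom_of \<phi>" "m \<in> dom_of \<psi>"
  shows "X m \<psi> = tangent \<phi> \<psi> m (X m \<phi>)"
proof -
  have "X m \<in> fibre M tangent m" using assms(1) by (simp add: smooth_sections_def)
  then show ?thesis using assms unfolding fibre_def by blast
qed

lemma vector_field_outside:
  assumes "X \<in> vector_fields M" "\<not> (\<phi> \<in> M \<and> m \<in> dom_of \<phi>)"
  shows "X m \<phi> = 0"
proof -
  have "X m \<in> fibre M tangent m" using assms(1) by (simp add: smooth_sections_def)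
  then show ?thesis using assms unfolding fibre_def by blast
qed

lemma vector_fieldI:
  assumes "\<And>m \<phi> \<psi>. \<phi> \<in> M \<Longrightarrow> \<psi> \<in> M \<Longrightarrow> m \<in> dom_of \<phi> \<Longrightarrow> m \<in> dom_of \<psi> \<Longrightarrow> X m \<psi> = tangent \<phi> \<psi> m (X m \<phi>)"
    and "\<And>m \<phi>. \<not> (\<phi> \<in> M \<and> m \<in> dom_of \<phi>) \<Longrightarrow> X m \<phi> = 0"
    and "\<And>\<phi>. \<phi> \<in> M \<Longrightarrow> smooth_on (img_of \<phi>) (field_rep \<phi> X)"
  shows "X \<in> vector_fields M"
  unfolding smooth_sections_def fibre_def using assms by blast

lemma smooth_functions_diff:
  "f \<in> smooth_functions M \<Longrightarrow> g \<in> smooth_functions M \<Longrightarrow> (\<lambda>m. f m - g m) \<in> smooth_functions M"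
  by (auto simp: smooth_functions_def fun_rep_def o_def intro!: smooth_on_diff open_img)

lemma smooth_functions_const: "(\<lambda>_. a) \<in> smooth_functions M"
  by (simp add: smooth_functions_def fun_rep_def o_def smooth_on_const)

lemma vector_field_add:
  assumes X: "X \<in> vector_fields M" and Y: "Y \<in> vector_fields M"
  shows "(\<lambda>m \<phi>. X m \<phi> + Y m \<phi>) \<in> vector_fields M"
proof (rule vector_fieldI)
  show "X m \<psi> + Y m \<psi> = tangent \<phi> \<psi> m (X m \<phi> + Y m \<phi>)"
    if "\<phi> \<in> M" "\<psi> \<in> M" "m \<in> dom_of \<phi>" "m \<in> dom_of \<psi>" for m \<phi> \<psi>
    by (simp only: linear_add[OF linear_tangent[OF that]]
        vector_field_tangent[OF X that] vector_field_tangent[OF Y that])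
  show "smooth_on (img_of \<phi>) (field_rep \<phi> (\<lambda>m \<phi>. X m \<phi> + Y m \<phi>))" if "\<phi> \<in> M" for \<phi>
    using smooth_on_add[OF open_img[OF that] smooth_field_rep[OF X that] smooth_field_rep[OF Y that]]
    by (simp add: field_rep_def[abs_def])
qed (simp add: vector_field_outside[OF X] vector_field_outside[OF Y])

lemma vector_field_scale:
  assumes f: "f \<in> smooth_functions M" and X: "X \<in> vector_fields M"
  shows "(\<lambda>m \<phi>. f m *\<^sub>R X m \<phi>) \<in> vector_fields M"
proof (rule vector_fieldI)
  show "f m *\<^sub>R X m \<psi> = tangent \<phi> \<psi> m (f m *\<^sub>R X m \<phi>)"
    if "\<phi> \<in> M" "\<psi> \<in> M" "m \<in> dom_of \<phi>" "m \<in> dom_of \<psi>" for m \<phi> \<psi>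
    by (simp only: linear_scale[OF linear_tangent[OF that]] vector_field_tangent[OF X that])
  show "smooth_on (img_of \<phi>) (field_rep \<phi> (\<lambda>m \<phi>. f m *\<^sub>R X m \<phi>))" if "\<phi> \<in> M" for \<phi>
    using smooth_on_scaleR[OF open_img[OF that] smooth_fun_rep[OF f that] smooth_field_rep[OF X that]]
    by (simp add: field_rep_def[abs_def] fun_rep_def)
qed (simp add: vector_field_outside[OF X])

lemma vector_field_zero: "(\<lambda>m \<phi>. 0) \<in> vector_fields M"
  by (rule vector_fieldI) (auto simp: linear_0[OF linear_tangent] field_rep_def[abs_def] smooth_on_const)

lemma vector_field_sum:
  assumes "\<And>b. b \<in> B \<Longrightarrow> X b \<in> vector_fields M"
  shows "(\<lambda>m \<phi>. \<Sum>b\<in>B. X b m \<phi>) \<in> vector_fields M"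
  using assms
  by (induction B rule: infinite_finite_induct) (auto intro: vector_field_zero vector_field_add)

lemmas lie_fun_eq = lie_fun_chart[OF smooth_manifold]

lemma lie_fun_rep:
  assumes "f \<in> smooth_functions M" "X \<in> vector_fields M" "\<phi> \<in> M" "w \<in> img_of \<phi>"
  shows "fun_rep \<phi> (lie_fun M X f) w = D1 (fun_rep \<phi> f) w (field_rep \<phi> X w)"
  using lie_fun_eq[OF assms(1,2,3) inv_chart_dom[OF assms(3,4)]]
  by (simp add: fun_rep_def field_rep_def map_inv_chart[OF assms(3,4)])

lemma lie_fun_smooth:
  assumes "f \<in> smooth_functions M" "X \<in> vector_fields M"
  shows "lie_fun M X f \<in> smooth_functions M"
proof -
  have "smooth_on (img_of \<phi>) (fun_rep \<phi> (lie_fun M X f))" if "\<phi> \<in> M" for \<phi>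
    by (rule smooth_on_cong[OF open_img[OF that] _ smooth_on_D1_field[OF fin_dim open_img[OF that]
            smooth_fun_rep[OF assms(1) that] smooth_field_rep[OF assms(2) that]]])
      (simp add: lie_fun_rep[OF assms that])
  then show ?thesis by (simp add: smooth_functions_def)
qed

section \<open>Globalising local functions and constant fields\<close>

definition cutoff :: "('m, 'e) chart \<Rightarrow> ('e \<Rightarrow> real) \<Rightarrow> 'e set \<Rightarrow> bool" where
  "cutoff \<phi> \<beta> W \<longleftrightarrow> smooth_on UNIV \<beta> \<and>
     (\<exists>K. compact K \<and> K \<subseteq> img_of \<phi> \<and> (\<forall>x. x \<notin> K \<longrightarrow> \<beta> x = 0)) \<and>
     open W \<and> W \<subseteq> img_of \<phi> \<and> (\<forall>x\<in>W. \<beta> x = 1)"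

lemma cutoff_smooth: "cutoff \<phi> \<beta> W \<Longrightarrow> smooth_on S \<beta>"
  using smooth_on_subset by (auto simp: cutoff_def)

lemma cutoff_exists:
  assumes "\<phi> \<in> M" "u \<in> img_of \<phi>"
  shows "\<exists>\<beta> W. cutoff \<phi> \<beta> W \<and> u \<in> W"
  using bump_exists[OF fin_dim open_img[OF assms(1)] assms(2)] unfolding cutoff_def by metis

definition cut_fun :: "('m, 'e) chart \<Rightarrow> ('e \<Rightarrow> real) \<Rightarrow> ('e \<Rightarrow> real) \<Rightarrow> 'm \<Rightarrow> real" where
  "cut_fun \<phi> \<beta> g m = (if m \<in> dom_of \<phi> then \<beta> (map_of_chart \<phi> m) * g (map_of_chart \<phi> m) else 0)"

text \<open>The conditions on \<psi> implement the convention of \<open>fibre\<close> that the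
  family is zero at all indices other than charts around \<open>m\<close>. The condition on \<phi>
  is the extension by zero.\<close>

definition cut_field :: "('m, 'e) chart \<Rightarrow> ('e \<Rightarrow> real) \<Rightarrow> 'e \<Rightarrow> ('m, 'e, 'e) field" where
  "cut_field \<phi> \<beta> x m \<psi> =
     (if \<psi> \<in> M \<and> m \<in> dom_of \<psi> \<and> m \<in> dom_of \<phi>
      then \<beta> (map_of_chart \<phi> m) *\<^sub>R tangent \<phi> \<psi> m x else 0)"

lemma cut_fun_smooth:
  assumes \<phi>: "\<phi> \<in> M" and \<beta>: "cutoff \<phi> \<beta> W" and g: "smooth_on (img_of \<phi>) g"
  shows "cut_fun \<phi> \<beta> g \<in> smooth_functions M"
proof -
  obtain K where K: "compact K" "K \<subseteq> img_of \<phi>" "\<And>x. x \<notin> K \<Longrightarrow> \<beta> x = 0"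
    using \<beta> unfolding cutoff_def by blast
  have s: "smooth_on (img_of \<phi>) (\<lambda>w. \<beta> w * g w)"
    by (intro smooth_on_mult open_img[OF \<phi>] g cutoff_smooth[OF \<beta>])
  have "smooth_on (img_of \<psi>) (\<lambda>w. cut_fun \<phi> \<beta> g (inv_chart \<psi> w))" if "\<psi> \<in> M" for \<psi>
  proof (rule smooth_on_extend_zero[OF \<phi> that K(1,2)])
    show "smooth_on (overlap \<phi> \<psi>) (\<lambda>w. \<beta> w * g w)"
      by (rule smooth_on_subset[OF s]) (auto simp: img_of_def)
    show "cut_fun \<phi> \<beta> g m = 0" if "m \<notin> inv_chart \<phi> ` K" for m
    proof (cases "m \<in> dom_of \<phi>")
      case True
      then have "map_of_chart \<phi> m \<notin> K" using that inv_chart_map[OF \<phi> True] by (metis imageI)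
      then show ?thesis by (simp add: cut_fun_def K(3))
    qed (simp add: cut_fun_def)
  qed (simp add: cut_fun_def)
  then show ?thesis by (simp add: smooth_functions_def fun_rep_def o_def)
qed

lemma cut_fun_rep:
  assumes "\<phi> \<in> M" "cutoff \<phi> \<beta> W" "w \<in> W"
  shows "fun_rep \<phi> (cut_fun \<phi> \<beta> g) w = g w"
  using assms inv_chart_dom[OF assms(1), of w] map_inv_chart[OF assms(1), of w]
  by (auto simp: fun_rep_def cut_fun_def cutoff_def)

lemma cut_field_smooth:
  assumes \<phi>: "\<phi> \<in> M" and \<beta>: "cutoff \<phi> \<beta> W"
  shows "cut_field \<phi> \<beta> x \<in> vector_fields M"
proof (rule vector_fieldI)
  obtain K where K: "compact K" "K \<subseteq> img_of \<phi>" "\<And>x. x \<notin> K \<Longrightarrow> \<beta> x = 0"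
    using \<beta> unfolding cutoff_def by blast
  show "cut_field \<phi> \<beta> x m \<theta> = tangent \<psi> \<theta> m (cut_field \<phi> \<beta> x m \<psi>)"
    if "\<psi> \<in> M" "\<theta> \<in> M" "m \<in> dom_of \<psi>" "m \<in> dom_of \<theta>" for m \<psi> \<theta>
  proof (cases "m \<in> dom_of \<phi>")
    case True
    then show ?thesis
      using that tangent_cocycle[OF \<phi> that(1,2) True that(3,4)]
      by (simp add: cut_field_def linear_scale[OF linear_tangent[OF that]])
  qed (simp add: cut_field_def linear_0[OF linear_tangent[OF that]])
  show "smooth_on (img_of \<psi>) (field_rep \<psi> (cut_field \<phi> \<beta> x))" if "\<psi> \<in> M" for \<psi>
    unfolding field_rep_def[abs_def]
  proof (rule smooth_on_extend_zero[OF \<phi> that K(1,2), where h = "\<lambda>m. cut_field \<phi> \<beta> x m \<psi>"])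
    \<comment> \<open>Expressed in the coordinate of \<phi>, the representative in \<psi> is the
      cutoff times a fixed-direction derivative of the transition map.\<close>
    show "smooth_on (overlap \<phi> \<psi>) (\<lambda>w. \<beta> w *\<^sub>R D1 (transition \<phi> \<psi>) w x)"
      using \<phi> that by (intro smooth_on_scaleR open_overlap smooth_on_D1 smooth_transition
          cutoff_smooth[OF \<beta>])
    show "cut_field \<phi> \<beta> x m \<psi> = 0" if "m \<notin> inv_chart \<phi> ` K" for m
    proof (cases "m \<in> dom_of \<phi>")
      case True
      then have "map_of_chart \<phi> m \<notin> K" using that inv_chart_map[OF \<phi> True] by (metis imageI)
      then show ?thesis by (simp add: cut_field_def K(3))
    qed (simp add: cut_field_def)
  qed (use that in \<open>simp add: cut_field_def tangent_def\<close>)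
qed (auto simp: cut_field_def)

lemma cut_field_rep:
  assumes \<phi>: "\<phi> \<in> M" and \<beta>: "cutoff \<phi> \<beta> W" and w: "w \<in> W"
  shows "field_rep \<phi> (cut_field \<phi> \<beta> x) w = x"
proof -
  have w': "w \<in> img_of \<phi>" "\<beta> w = 1" using \<beta> w by (auto simp: cutoff_def)
  show ?thesis
    using inv_chart_dom[OF \<phi> w'(1)] w'(2) \<phi> tangent_refl[OF \<phi> inv_chart_dom[OF \<phi> w'(1)]]
    by (simp add: field_rep_def cut_field_def map_inv_chart[OF \<phi> w'(1)])
qed

end

section \<open>Christoffel symbols\<close>

locale manifold_connection = manifold M
  for M :: "('m::t2_space, 'e::banach) chart set" +
  fixes N :: "('m, 'e, 'e) connection"
  assumes koszul: "koszul_connection M tangent N"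
begin

section \<open>Algebraic rules for a Koszul connection and its locality\<close>

lemma connection_closed:
  "X \<in> vector_fields M \<Longrightarrow> Y \<in> vector_fields M \<Longrightarrow> N X Y \<in> vector_fields M"
  using koszul unfolding koszul_connection_def by blast

lemma connection_add_left:
  "X \<in> vector_fields M \<Longrightarrow> X' \<in> vector_fields M \<Longrightarrow> Y \<in> vector_fields M \<Longrightarrow>
    N (\<lambda>m \<phi>. X m \<phi> + X' m \<phi>) Y = (\<lambda>m \<phi>. N X Y m \<phi> + N X' Y m \<phi>)"
  using koszul unfolding koszul_connection_def by blast

lemma connection_scale_left:
  "f \<in> smooth_functions M \<Longrightarrow> X \<in> vector_fields M \<Longrightarrow> Y \<in> vector_fields M \<Longrightarrow>
    N (\<lambda>m \<phi>. f m *\<^sub>R X m \<phi>) Y = (\<lambda>m \<phi>. f m *\<^sub>R N X Y m \<phi>)"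
  using koszul unfolding koszul_connection_def by blast

lemma connection_add_right:
  "X \<in> vector_fields M \<Longrightarrow> Y \<in> vector_fields M \<Longrightarrow> Y' \<in> vector_fields M \<Longrightarrow>
    N X (\<lambda>m \<phi>. Y m \<phi> + Y' m \<phi>) = (\<lambda>m \<phi>. N X Y m \<phi> + N X Y' m \<phi>)"
  using koszul unfolding koszul_connection_def by blast

lemma connection_leibniz:
  "f \<in> smooth_functions M \<Longrightarrow> X \<in> vector_fields M \<Longrightarrow> Y \<in> vector_fields M \<Longrightarrow>
    N X (\<lambda>m \<phi>. f m *\<^sub>R Y m \<phi>) = (\<lambda>m \<phi>. lie_fun M X f m *\<^sub>R Y m \<phi> + f m *\<^sub>R N X Y m \<phi>)"
  using koszul unfolding koszul_connection_def by blast

lemma connection_zero_left: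
  assumes "Y \<in> vector_fields M"
  shows "N (\<lambda>m \<phi>. 0) Y = (\<lambda>m \<phi>. 0)"
  using connection_scale_left[OF smooth_functions_const[of 0] vector_field_zero assms] by simp

lemma connection_zero_right:
  assumes "X \<in> vector_fields M"
  shows "N X (\<lambda>m \<phi>. 0) = (\<lambda>m \<phi>. 0)"
  using connection_leibniz[OF smooth_functions_const[of 0] assms vector_field_zero] by simp

lemma connection_sum_left:
  assumes "\<And>b. b \<in> B \<Longrightarrow> f b \<in> smooth_functions M" "\<And>b. b \<in> B \<Longrightarrow> E b \<in> vector_fields M"
    and Y: "Y \<in> vector_fields M" and "finite B"
  shows "N (\<lambda>m \<phi>. \<Sum>b\<in>B. f b m *\<^sub>R E b m \<phi>) Y = (\<lambda>m \<phi>. \<Sum>b\<in>B. f b m *\<^sub>R N (E b) Y m \<phi>)"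
  using assms(4,1,2)
proof (induction B rule: finite_induct)
  case empty
  then show ?case using connection_zero_left[OF Y] by simp
next
  case (insert c B)
  have "(\<lambda>m \<phi>. \<Sum>b\<in>B. f b m *\<^sub>R E b m \<phi>) \<in> vector_fields M"
    using insert.prems by (intro vector_field_sum vector_field_scale) auto
  moreover have "(\<lambda>m \<phi>. f c m *\<^sub>R E c m \<phi>) \<in> vector_fields M"
    using insert.prems by (intro vector_field_scale) auto
  ultimately show ?case using insert Y
    by (simp add: connection_add_left connection_scale_left)
qed

lemma connection_sum_right:
  assumes "\<And>b. b \<in> B \<Longrightarrow> f b \<in> smooth_functions M" "\<And>b. b \<in> B \<Longrightarrow> E b \<in> vector_fields M"
    and X: "X \<in> vector_fields M" and "finite B"
  shows "N X (\<lambda>m \<phi>. \<Sum>b\<in>B. f b m *\<^sub>R E b m \<phi>) =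
    (\<lambda>m \<phi>. \<Sum>b\<in>B. lie_fun M X (f b) m *\<^sub>R E b m \<phi> + f b m *\<^sub>R N X (E b) m \<phi>)"
  using assms(4,1,2)
proof (induction B rule: finite_induct)
  case empty
  then show ?case using connection_zero_right[OF X] by simp
next
  case (insert c B)
  have "(\<lambda>m \<phi>. \<Sum>b\<in>B. f b m *\<^sub>R E b m \<phi>) \<in> vector_fields M"
    using insert.prems by (intro vector_field_sum vector_field_scale) auto
  moreover have "(\<lambda>m \<phi>. f c m *\<^sub>R E c m \<phi>) \<in> vector_fields M"
    using insert.prems by (intro vector_field_scale) auto
  ultimately show ?case using insert X
    by (simp add: connection_add_right connection_leibniz)
qed

text \<open>
  Multiplying \<^term>\<open>X\<close> and \<^term>\<open>Y\<close> by the square of a cutoff makes them exact global combinations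
  of the cut-off coordinate fields, and does not change \<^term>\<open>N X Y\<close> where the cutoff is \<open>1\<close>.
\<close>

lemma connection_local:
  assumes \<phi>: "\<phi> \<in> M" and \<beta>: "cutoff \<phi> \<beta> W" and u: "u \<in> W" and co: "coordinates B r"
    and X: "X \<in> vector_fields M" and Y: "Y \<in> vector_fields M"
  shows "field_rep \<phi> (N X Y) u = D1 (field_rep \<phi> Y) u (field_rep \<phi> X u) +
    (\<Sum>b\<in>B. \<Sum>c\<in>B. (r b (field_rep \<phi> X u) * r c (field_rep \<phi> Y u)) *\<^sub>R
      field_rep \<phi> (N (cut_field \<phi> \<beta> b) (cut_field \<phi> \<beta> c)) u)"
proof -
  note fin = coordinatesD(1)[OF co] and r = coordinatesD(2)[OF co] and rep = coordinatesD(3)[OF co]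
  let ?E = "cut_field \<phi> \<beta>" and ?s = "cut_fun \<phi> \<beta> \<beta>"
  let ?f = "\<lambda>Z b. cut_fun \<phi> \<beta> (\<lambda>w. r b (field_rep \<phi> Z w))"
  define m where "m = inv_chart \<phi> u"
  have W: "open W" "W \<subseteq> img_of \<phi>" "\<And>w. w \<in> W \<Longrightarrow> \<beta> w = 1" using \<beta> by (auto simp: cutoff_def)
  have ui: "u \<in> img_of \<phi>" using u W by blast
  have m: "m \<in> dom_of \<phi>" "map_of_chart \<phi> m = u"
    unfolding m_def by (simp_all add: inv_chart_dom map_inv_chart \<phi> ui)
  have at_u: "field_rep \<phi> Z u = Z m \<phi>" for Z :: "('m, 'e, 'e) field"
    by (simp add: field_rep_def m_def)
  have E: "?E b \<in> vector_fields M" for b by (rule cut_field_smooth[OF \<phi> \<beta>])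
  have s: "?s \<in> smooth_functions M" by (rule cut_fun_smooth[OF \<phi> \<beta> cutoff_smooth[OF \<beta>]])
  have f: "?f Z b \<in> smooth_functions M" if "Z \<in> vector_fields M" for Z b
    by (rule cut_fun_smooth[OF \<phi> \<beta> smooth_on_linear[OF open_img[OF \<phi>] r smooth_field_rep[OF that \<phi>]]])
  \<comment> \<open>One factor \<beta> goes into the coefficient function and the other into the
    frame field, so both are smooth on all of the manifold. The identity holds at every point and
    index, which the global axioms demand.\<close>
  have dec: "(\<lambda>p \<psi>. ?s p *\<^sub>R Z p \<psi>) = (\<lambda>p \<psi>. \<Sum>b\<in>B. ?f Z b p *\<^sub>R ?E b p \<psi>)"
    if Z: "Z \<in> vector_fields M" for Z
  proof (intro ext)
    fix p \<psi>
    consider "p \<notin> dom_of \<phi>" | "\<not> (\<psi> \<in> M \<and> p \<in> dom_of \<psi>)"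
      | "p \<in> dom_of \<phi>" "\<psi> \<in> M" "p \<in> dom_of \<psi>" by blast
    then show "?s p *\<^sub>R Z p \<psi> = (\<Sum>b\<in>B. ?f Z b p *\<^sub>R ?E b p \<psi>)"
    proof cases
      case 1
      then show ?thesis by (simp add: cut_fun_def)
    next
      case 2
      then have "?E b p \<psi> = 0" for b unfolding cut_field_def by meson
      then show ?thesis using vector_field_outside[OF Z 2] by simp
    next
      case 3
      let ?a = "\<beta> (map_of_chart \<phi> p)"
      have "Z p \<psi> = tangent \<phi> \<psi> p (Z p \<phi>)" by (rule vector_field_tangent[OF Z \<phi> 3(2,1,3)])
      also have "\<dots> = (\<Sum>b\<in>B. r b (Z p \<phi>) *\<^sub>R tangent \<phi> \<psi> p b)"
        by (rule linear_coordinates[OF co linear_tangent[OF \<phi> 3(2,1,3)]])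
      finally have "?s p *\<^sub>R Z p \<psi> = (\<Sum>b\<in>B. (?a * ?a * r b (Z p \<phi>)) *\<^sub>R tangent \<phi> \<psi> p b)"
        using 3 by (simp add: cut_fun_def scaleR_sum_right)
      also have "\<dots> = (\<Sum>b\<in>B. ?f Z b p *\<^sub>R ?E b p \<psi>)"
        using 3 by (intro sum.cong) (simp_all add: cut_fun_def cut_field_def field_rep_map[OF \<phi> 3(1)])
      finally show ?thesis .
    qed
  qed
  have s1: "?s m = 1" using m u W(3) by (simp add: cut_fun_def)
  have "(fun_rep \<phi> ?s has_derivative (\<lambda>_. 0)) (at u)"
    by (rule has_derivative_transform_within_open[OF has_derivative_const W(1) u])
      (use cut_fun_rep[OF \<phi> \<beta>] W(3) in simp)
  then have ls: "lie_fun M X ?s m = 0"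
    using lie_fun_eq[OF s X \<phi> m(1)] m(2) by (simp add: D1_eq)
  have fm: "?f Z b m = r b (Z m \<phi>)" for Z b
    using m u W(3) at_u by (simp add: cut_fun_def)
  have Em: "?E b m \<phi> = b" for b
    using cut_field_rep[OF \<phi> \<beta> u] by (simp add: at_u)
  \<comment> \<open>The derivatives of the coefficients reassemble into the term
    \<open>D1 (field_rep \<phi> Y) u\<close>; what remains is bilinear in the values at
    \<open>u\<close>.\<close>
  have lf: "lie_fun M (?E b) (?f Y c) m = r c (D1 (field_rep \<phi> Y) u b)" for b c
  proof -
    have "((\<lambda>w. r c (field_rep \<phi> Y w)) has_derivative (\<lambda>x. r c (D1 (field_rep \<phi> Y) u x))) (at u)"
      by (rule bounded_linear.has_derivative[OF r
            smooth_on_has_derivative[OF smooth_field_rep[OF Y \<phi>] ui]])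
    then have "(fun_rep \<phi> (?f Y c) has_derivative (\<lambda>x. r c (D1 (field_rep \<phi> Y) u x))) (at u)"
      by (rule has_derivative_transform_within_open[OF _ W(1) u]) (simp add: cut_fun_rep[OF \<phi> \<beta>])
    then show ?thesis
      using lie_fun_eq[OF f[OF Y] E \<phi> m(1)] m(2) Em by (simp add: D1_eq)
  qed
  let ?sX = "\<lambda>p \<psi>. ?s p *\<^sub>R X p \<psi>" and ?sY = "\<lambda>p \<psi>. ?s p *\<^sub>R Y p \<psi>"
  have sY: "?sY \<in> vector_fields M" by (rule vector_field_scale[OF s Y])
  have "N X Y m \<phi> = N ?sX ?sY m \<phi>"
    by (simp add: connection_scale_left[OF s X sY] connection_leibniz[OF s X Y] s1 ls)
  also have "\<dots> = (\<Sum>b\<in>B. r b (X m \<phi>) *\<^sub>R N (?E b) ?sY m \<phi>)"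
    using connection_sum_left[OF f[OF X] E sY fin] by (simp add: dec[OF X] fm)
  also have "\<dots> = (\<Sum>b\<in>B. r b (X m \<phi>) *\<^sub>R (\<Sum>c\<in>B. r c (D1 (field_rep \<phi> Y) u b) *\<^sub>R c +
      r c (Y m \<phi>) *\<^sub>R N (?E b) (?E c) m \<phi>))"
    using connection_sum_right[OF f[OF Y] E E fin] by (simp add: dec[OF Y] fm lf Em)
  also have "\<dots> = (\<Sum>b\<in>B. r b (X m \<phi>) *\<^sub>R D1 (field_rep \<phi> Y) u b) +
      (\<Sum>b\<in>B. \<Sum>c\<in>B. (r b (X m \<phi>) * r c (Y m \<phi>)) *\<^sub>R N (?E b) (?E c) m \<phi>)"
    by (simp add: sum.distrib rep scaleR_add_right scaleR_sum_right)
  also have "(\<Sum>b\<in>B. r b (X m \<phi>) *\<^sub>R D1 (field_rep \<phi> Y) u b) = D1 (field_rep \<phi> Y) u (X m \<phi>)"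
    by (rule linear_coordinates[OF co smooth_on_linear_D1[OF smooth_field_rep[OF Y \<phi>] ui], symmetric])
  finally show ?thesis by (simp only: at_u)
qed

section \<open>Existence, uniqueness and differentiability of the Christoffel symbol\<close>

abbreviation \<Gamma> :: "('m, 'e) chart \<Rightarrow> 'e \<Rightarrow> 'e \<Rightarrow> 'e \<Rightarrow> 'e" where
  "\<Gamma> \<equiv> christoffel M tangent N"

text \<open>The neighbourhood is chosen before the vector, so that several constant fields are
  available on one common open set.\<close>

lemma constant_field_exists:
  assumes "\<phi> \<in> M" "u \<in> img_of \<phi>"
  shows "\<exists>W. open W \<and> u \<in> W \<and> W \<subseteq> img_of \<phi> \<and>
    (\<forall>x. \<exists>X\<in>vector_fields M. \<forall>w\<in>W. field_rep \<phi> X w = x)"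
proof -
  obtain \<beta> W where \<beta>: "cutoff \<phi> \<beta> W" and u: "u \<in> W" using cutoff_exists[OF assms] by blast
  have "\<exists>X\<in>vector_fields M. \<forall>w\<in>W. field_rep \<phi> X w = x" for x
    using cut_field_rep[OF assms(1) \<beta>] by (intro bexI[OF _ cut_field_smooth[OF assms(1) \<beta>, of x]] ballI)
  moreover have "open W" "W \<subseteq> img_of \<phi>" using \<beta> by (simp_all add: cutoff_def)
  ultimately show ?thesis using u by blast
qed

text \<open>Existence is the bilinear remainder in \<open>connection_local\<close>. Uniqueness holds
  because cut-off constant fields attain every pair of values at \<open>u\<close>, so the defining
  equation determines the symbol on all arguments.\<close>

lemma christoffel_properties:
  assumes \<phi>: "\<phi> \<in> M" and u: "u \<in> img_of \<phi>"
  shows bilinear_christoffel: "bilinear (\<Gamma> \<phi> u)"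
    and christoffel_connection: "\<And>X Y. X \<in> vector_fields M \<Longrightarrow> Y \<in> vector_fields M \<Longrightarrow>
      field_rep \<phi> (N X Y) u =
        D1 (field_rep \<phi> Y) u (field_rep \<phi> X u) - \<Gamma> \<phi> u (field_rep \<phi> X u) (field_rep \<phi> Y u)"
proof -
  let ?P = "\<lambda>G. bilinear G \<and> (\<forall>X\<in>vector_fields M. \<forall>Y\<in>vector_fields M. field_rep \<phi> (N X Y) u =
        D1 (field_rep \<phi> Y) u (field_rep \<phi> X u) - G (field_rep \<phi> X u) (field_rep \<phi> Y u))"
  obtain \<beta> W where \<beta>: "cutoff \<phi> \<beta> W" and uW: "u \<in> W" using cutoff_exists[OF assms] by blast
  obtain B :: "'e set" and r where co: "coordinates B r"
    using coordinates_exist[OF fin_dim] by blast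
  note lin = bounded_linear.linear[OF coordinatesD(2)[OF co]]
  define G where "G x y = - (\<Sum>b\<in>B. \<Sum>c\<in>B. (r b x * r c y) *\<^sub>R
      field_rep \<phi> (N (cut_field \<phi> \<beta> b) (cut_field \<phi> \<beta> c)) u)" for x y
  have "bilinear G"
    unfolding bilinear_def G_def
    by (auto intro!: linearI simp: linear_add[OF lin] linear_scale[OF lin] algebra_simps
        sum.distrib scaleR_sum_right)
  moreover have "\<forall>X\<in>vector_fields M. \<forall>Y\<in>vector_fields M. field_rep \<phi> (N X Y) u =
        D1 (field_rep \<phi> Y) u (field_rep \<phi> X u) - G (field_rep \<phi> X u) (field_rep \<phi> Y u)"
    using connection_local[OF \<phi> \<beta> uW co] by (simp add: G_def)
  ultimately have ex: "?P G" by blast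
  have "G1 = G2" if "?P G1" "?P G2" for G1 G2
  proof (intro ext)
    fix x y
    note cf = cut_field_smooth[OF \<phi> \<beta>]
    have "field_rep \<phi> (N (cut_field \<phi> \<beta> x) (cut_field \<phi> \<beta> y)) u =
        D1 (field_rep \<phi> (cut_field \<phi> \<beta> y)) u (field_rep \<phi> (cut_field \<phi> \<beta> x) u) -
        G' (field_rep \<phi> (cut_field \<phi> \<beta> x) u) (field_rep \<phi> (cut_field \<phi> \<beta> y) u)"
      if "?P G'" for G' using that cf by blast
    from this[OF that(1)] this[OF that(2)]
    show "G1 x y = G2 x y" by (simp add: cut_field_rep[OF \<phi> \<beta> uW])
  qed
  with ex have "\<exists>!G. ?P G" by blast
  then have "?P (\<Gamma> \<phi> u)" unfolding christoffel_def by (rule theI')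
  then show "bilinear (\<Gamma> \<phi> u)"
    "\<And>X Y. X \<in> vector_fields M \<Longrightarrow> Y \<in> vector_fields M \<Longrightarrow> field_rep \<phi> (N X Y) u =
        D1 (field_rep \<phi> Y) u (field_rep \<phi> X u) - \<Gamma> \<phi> u (field_rep \<phi> X u) (field_rep \<phi> Y u)"
    by blast+
qed

lemma connection_constant_fields:
  assumes \<phi>: "\<phi> \<in> M" and W: "open W" "W \<subseteq> img_of \<phi>" "w \<in> W"
    and X: "X \<in> vector_fields M" "\<And>v. v \<in> W \<Longrightarrow> field_rep \<phi> X v = x"
    and Y: "Y \<in> vector_fields M" "\<And>v. v \<in> W \<Longrightarrow> field_rep \<phi> Y v = y"
  shows "field_rep \<phi> (N X Y) w = - \<Gamma> \<phi> w x y"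
proof -
  have "(field_rep \<phi> Y has_derivative (\<lambda>_. 0)) (at w)"
    by (rule has_derivative_transform_within_open[OF has_derivative_const W(1,3)]) (simp add: Y(2))
  then show ?thesis
    using christoffel_connection[OF \<phi> _ X(1) Y(1), of w] W X(2) Y(2) by (auto simp: D1_eq)
qed

text \<open>The symbol is defined separately at each point, which says nothing about its variation.
  For constant fields on a common neighbourhood, however, it is minus the local representative of
  the smooth field \<open>N X Y\<close>.\<close>

lemma christoffel_has_derivative:
  assumes \<phi>: "\<phi> \<in> M" and u: "u \<in> img_of \<phi>"
  shows "((\<lambda>w. \<Gamma> \<phi> w x y) has_derivative D1 (\<lambda>w. \<Gamma> \<phi> w x y) u) (at u)"
proof -
  obtain W where W: "open W" "u \<in> W" "W \<subseteq> img_of \<phi>"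
    and c: "\<And>x. \<exists>X\<in>vector_fields M. \<forall>w\<in>W. field_rep \<phi> X w = x"
    using constant_field_exists[OF assms] by blast
  obtain X Y where X: "X \<in> vector_fields M" "\<And>w. w \<in> W \<Longrightarrow> field_rep \<phi> X w = x"
    and Y: "Y \<in> vector_fields M" "\<And>w. w \<in> W \<Longrightarrow> field_rep \<phi> Y w = y"
    using c by metis
  have "((\<lambda>w. - field_rep \<phi> (N X Y) w) has_derivative (\<lambda>z. - D1 (field_rep \<phi> (N X Y)) u z)) (at u)"
    by (intro has_derivative_minus smooth_on_has_derivative[OF smooth_field_rep]
        connection_closed X Y \<phi> u)
  then have "((\<lambda>w. \<Gamma> \<phi> w x y) has_derivative (\<lambda>z. - D1 (field_rep \<phi> (N X Y)) u z)) (at u)"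
    by (rule has_derivative_transform_within_open[OF _ W(1,2)])
      (simp add: connection_constant_fields[OF \<phi> W(1,3) _ X Y])
  then show ?thesis using frechet_derivative_works differentiable_def by blast
qed

section \<open>Hessian structures\<close>

lemma hess2_smooth:
  assumes "f \<in> smooth_functions M" "Y \<in> vector_fields M" "Z \<in> vector_fields M"
  shows "hess2 M N f Y Z \<in> smooth_functions M"
proof -
  have "hess2 M N f Y Z = (\<lambda>m. lie_fun M Y (lie_fun M Z f) m - lie_fun M (N Y Z) f m)"
    by (rule ext) (simp add: hess2_def)
  then show ?thesis using assms by (simp add: smooth_functions_diff lie_fun_smooth connection_closed)
qed

text \<open>The terms Df(DZ Y) from the iterated derivative and from the connection cancel, so the
  result depends on the fields only through their values at \<open>u\<close>. The sign convention
  for \<Gamma> makes its term positive.\<close>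

lemma hess2_rep:
  assumes f: "f \<in> smooth_functions M" and Y: "Y \<in> vector_fields M" and Z: "Z \<in> vector_fields M"
    and \<phi>: "\<phi> \<in> M" and u: "u \<in> img_of \<phi>"
  shows "fun_rep \<phi> (hess2 M N f Y Z) u =
    D2 (fun_rep \<phi> f) u (field_rep \<phi> Y u) (field_rep \<phi> Z u) +
    D1 (fun_rep \<phi> f) u (\<Gamma> \<phi> u (field_rep \<phi> Y u) (field_rep \<phi> Z u))"
proof -
  let ?F = "fun_rep \<phi> f" and ?Y = "field_rep \<phi> Y" and ?Z = "field_rep \<phi> Z"
  note o = open_img[OF \<phi>] and sF = smooth_fun_rep[OF f \<phi>]
  have "((\<lambda>w. D1 ?F w (?Z w)) has_derivative (\<lambda>y. D2 ?F u y (?Z u) + D1 ?F u (D1 ?Z u y))) (at u)"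
    by (rule D1_field_has_derivative[OF fin_dim o u sF
          smooth_on_has_derivative[OF smooth_field_rep[OF Z \<phi>] u]])
  then have "(fun_rep \<phi> (lie_fun M Z f) has_derivative
      (\<lambda>y. D2 ?F u y (?Z u) + D1 ?F u (D1 ?Z u y))) (at u)"
    by (rule has_derivative_transform_within_open[OF _ o u]) (simp add: lie_fun_rep[OF f Z \<phi>])
  then have "fun_rep \<phi> (lie_fun M Y (lie_fun M Z f)) u =
      D2 ?F u (?Y u) (?Z u) + D1 ?F u (D1 ?Z u (?Y u))"
    using lie_fun_rep[OF lie_fun_smooth[OF f Z] Y \<phi> u] by (simp add: D1_eq)
  moreover have "fun_rep \<phi> (lie_fun M (N Y Z) f) u =
      D1 ?F u (D1 ?Z u (?Y u)) - D1 ?F u (\<Gamma> \<phi> u (?Y u) (?Z u))"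
    using lie_fun_rep[OF f connection_closed[OF Y Z] \<phi> u]
    by (simp add: christoffel_connection[OF \<phi> u Y Z] linear_diff[OF smooth_on_linear_D1[OF sF u]])
  ultimately show ?thesis by (simp add: fun_rep_def hess2_def)
qed

text \<open>The three second-derivative terms keep the order of arguments in which they arise; the
  test functions used later have an explicitly symmetric second derivative, which merges them into
  one term with factor 3.\<close>

lemma hess3_constant_field:
  assumes f: "f \<in> smooth_functions M" and \<phi>: "\<phi> \<in> M"
    and W: "open W" "u \<in> W" "W \<subseteq> img_of \<phi>"
    and X: "X \<in> vector_fields M" "\<And>w. w \<in> W \<Longrightarrow> field_rep \<phi> X w = x"
  shows "fun_rep \<phi> (hess3 M N f X X X) u =
    D3 (fun_rep \<phi> f) u x x x +
    (D2 (fun_rep \<phi> f) u x (\<Gamma> \<phi> u x x) + D2 (fun_rep \<phi> f) u (\<Gamma> \<phi> u x x) x +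
      D2 (fun_rep \<phi> f) u x (\<Gamma> \<phi> u x x)) +
    D1 (fun_rep \<phi> f) u (D1 (\<lambda>w. \<Gamma> \<phi> w x x) u x + \<Gamma> \<phi> u (\<Gamma> \<phi> u x x) x + \<Gamma> \<phi> u x (\<Gamma> \<phi> u x x))"
proof -
  let ?F = "fun_rep \<phi> f" and ?G = "\<lambda>w. \<Gamma> \<phi> w x x"
  have u: "u \<in> img_of \<phi>" using W by blast
  note o = open_img[OF \<phi>] and sF = smooth_fun_rep[OF f \<phi>]
  note cl = connection_closed[OF X(1) X(1)]
  have Xu: "field_rep \<phi> X u = x" using W X by blast
  \<comment> \<open>Although \<open>N X X\<close> need not be constant near \<open>u\<close>, its
    value there is enough, since \<open>hess2_rep\<close> is pointwise in its fields.\<close>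
  have Nu: "field_rep \<phi> (N X X) u = - ?G u" by (rule connection_constant_fields[OF \<phi> W(1,3,2) X X])
  note lD1 = smooth_on_linear_D1[OF sF u] and lD2 = D2_linear[OF o sF u]
  have lD2': "D2 ?F u (- a) y = - D2 ?F u a y" for a y
    unfolding D2_def by (rule linear_neg[OF smooth_on_linear_D1[OF smooth_on_D1[OF sF] u]])
  have "((\<lambda>w. D2 ?F w x x) has_derivative (\<lambda>z. D3 ?F u z x x)) (at u)"
    unfolding D3_def D2_def
    by (rule smooth_on_has_derivative[OF smooth_on_D1[OF smooth_on_D1[OF sF]] u])
  from has_derivative_add[OF this
      D1_field_has_derivative[OF fin_dim o u sF christoffel_has_derivative[OF \<phi> u]]]
  have "(fun_rep \<phi> (hess2 M N f X X) has_derivative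
      (\<lambda>z. D3 ?F u z x x + (D2 ?F u z (?G u) + D1 ?F u (D1 ?G u z)))) (at u)"
    by (rule has_derivative_transform_within_open[OF _ W(1,2)])
      (use W(3) X(2) in \<open>simp add: hess2_rep[OF f X(1) X(1) \<phi>] subset_iff\<close>)
  then have "fun_rep \<phi> (lie_fun M X (hess2 M N f X X)) u =
      D3 ?F u x x x + (D2 ?F u x (?G u) + D1 ?F u (D1 ?G u x))"
    by (simp add: lie_fun_rep[OF hess2_smooth[OF f X(1) X(1)] X(1) \<phi> u] D1_eq Xu)
  moreover have "fun_rep \<phi> (hess2 M N f (N X X) X) u = - D2 ?F u (?G u) x - D1 ?F u (\<Gamma> \<phi> u (?G u) x)"
    by (simp add: hess2_rep[OF f cl X(1) \<phi> u] Nu Xu lD2' bilinear_lneg[OF bilinear_christoffel[OF \<phi> u]]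
        linear_neg[OF lD1])
  moreover have "fun_rep \<phi> (hess2 M N f X (N X X)) u = - D2 ?F u x (?G u) - D1 ?F u (\<Gamma> \<phi> u x (?G u))"
    by (simp add: hess2_rep[OF f X(1) cl \<phi> u] Nu Xu linear_neg[OF lD2] linear_neg[OF lD1]
        bilinear_rneg[OF bilinear_christoffel[OF \<phi> u]])
  moreover have "fun_rep \<phi> (hess3 M N f X X X) u = fun_rep \<phi> (lie_fun M X (hess2 M N f X X)) u -
      fun_rep \<phi> (hess2 M N f (N X X) X) u - fun_rep \<phi> (hess2 M N f X (N X X)) u"
    by (simp add: fun_rep_def hess3_def)
  ultimately show ?thesis by (simp add: linear_add[OF lD1])
qed

end

text \<open>A symmetric tensor is realised as a functional on bilinear forms. Evaluation at
  \<open>b\<close> is linear and takes the prescribed values on products, so uniqueness in the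
  universal property identifies it with the lift.\<close>

lemma sym_lift_blinfun:
  fixes b :: "'e::real_normed_vector \<Rightarrow>\<^sub>L 'e \<Rightarrow>\<^sub>L real"
  assumes "finite_dimensional TYPE('e)"
  shows "sym_lift (\<lambda>y z. (b y z + b z y) / 2) s = Rep_sym_tensor s b"
proof -
  have "bilinear (\<lambda>y z. (b y z + b z y) / 2)"
    unfolding bilinear_def
    by (auto intro!: linearI simp: blinfun.bilinear_simps add_divide_distrib distrib_left)
  moreover have "linear (\<lambda>s. Rep_sym_tensor s b)"
    by (rule linearI) (simp_all add: plus_sym_tensor.rep_eq scaleR_sym_tensor.rep_eq blinfun.bilinear_simps)
  moreover have "Rep_sym_tensor (y \<Delta> z) b = (b y z + b z y) / 2" for y z
    by (simp add: sym_prod.rep_eq sym_eval_apply)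
  ultimately have "sym_lift (\<lambda>y z. (b y z + b z y) / 2) = (\<lambda>s. Rep_sym_tensor s b)"
    unfolding sym_lift_def
    by (intro the1_equality sym_tensor_universal[OF assms]) (auto simp: add.commute)
  then show ?thesis by simp
qed

lemma sym_tensor_eqI:
  "(\<And>b. Rep_sym_tensor s b = Rep_sym_tensor t b) \<Longrightarrow> s = t"
  by (simp add: blinfun_eqI flip: Rep_sym_tensor_inject)

context manifold_connection
begin

text \<open>First and second derivatives at \<open>u\<close> can be prescribed independently. The
  form \<open>b\<close> need not be symmetric, so that tensors can be tested against every bounded
  bilinear form.\<close>

lemma polynomial_function_exists:
  fixes l :: "'e \<Rightarrow> real" and b :: "'e \<Rightarrow>\<^sub>L 'e \<Rightarrow>\<^sub>L real"
  assumes \<phi>: "\<phi> \<in> M" and u: "u \<in> img_of \<phi>" and l: "bounded_linear l"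
  shows "\<exists>f\<in>smooth_functions M. D1 (fun_rep \<phi> f) u = l \<and>
    D2 (fun_rep \<phi> f) u = (\<lambda>y z. (b y z + b z y) / 2)"
proof -
  obtain \<beta> W where \<beta>: "cutoff \<phi> \<beta> W" and uW: "u \<in> W" using cutoff_exists[OF \<phi> u] by blast
  have W: "open W" using \<beta> by (simp add: cutoff_def)
  \<comment> \<open>The quadratic part is centred at \<open>u\<close> so as not to contribute to the
    first derivative there; the factor 1/2 makes its second derivative the symmetrisation of
    \<open>b\<close>.\<close>
  define F where "F w = l w + b (w - u) (w - u) / 2" for w
  have F': "(F has_derivative (\<lambda>v. l v + (b (w - u) v + b v (w - u)) / 2)) (at w)" for w
  proof -
    have d: "((\<lambda>w. w - u) has_derivative (\<lambda>v. v)) (at w)"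
      by (auto intro!: derivative_eq_intros)
    have "((\<lambda>w. b (w - u)) has_derivative (\<lambda>v. b v)) (at w)"
      by (rule bounded_linear.has_derivative[OF blinfun.bounded_linear_right d])
    from blinfun.FDERIV[OF this d]
    have "((\<lambda>w. b (w - u) (w - u)) has_derivative (\<lambda>v. b (w - u) v + b v (w - u))) (at w)" .
    then show ?thesis
      unfolding F_def
      by (intro has_derivative_add bounded_linear.has_derivative[OF l has_derivative_ident]
          bounded_linear.has_derivative[OF bounded_linear_divide])
  qed
  have lb: "bounded_linear (\<lambda>w. (b w v + b v w) / 2)" for v
    by (intro bounded_linear_compose[OF bounded_linear_divide] bounded_linear_add
        blinfun.bounded_linear_right
        bounded_linear_compose[OF blinfun.bounded_linear_left blinfun.bounded_linear_right])
  have sF: "smooth_on UNIV F"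
    by (rule smooth_onI[OF open_UNIV F'])
      (intro smooth_on_add smooth_on_const smooth_on_linear[OF _ lb] smooth_on_diff smooth_on_id open_UNIV)
  define f where "f = cut_fun \<phi> \<beta> F"
  have f: "f \<in> smooth_functions M"
    unfolding f_def by (rule cut_fun_smooth[OF \<phi> \<beta> smooth_on_subset[OF sF subset_UNIV]])
  have d1: "(fun_rep \<phi> f has_derivative (\<lambda>v. l v + (b (w - u) v + b v (w - u)) / 2)) (at w)"
    if "w \<in> W" for w
    by (rule has_derivative_transform_within_open[OF F' W that])
      (simp add: f_def cut_fun_rep[OF \<phi> \<beta>])
  have D1: "D1 (fun_rep \<phi> f) w v = l v + (b (w - u) v + b v (w - u)) / 2" if "w \<in> W" for w v
    by (rule D1_eq[OF d1[OF that]])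
  have "((\<lambda>w. w - u) has_derivative (\<lambda>v. v)) (at u)"
    by (auto intro!: derivative_eq_intros)
  from has_derivative_add[OF has_derivative_const bounded_linear.has_derivative[OF lb this]]
  have "((\<lambda>w. l z + (b (w - u) z + b z (w - u)) / 2) has_derivative (\<lambda>y. (b y z + b z y) / 2)) (at u)" for z
    by simp
  then have "((\<lambda>w. D1 (fun_rep \<phi> f) w z) has_derivative (\<lambda>y. (b y z + b z y) / 2)) (at u)" for z
    by (rule has_derivative_transform_within_open[OF _ W uW]) (simp add: D1)
  then have "D2 (fun_rep \<phi> f) u y z = (b y z + b z y) / 2" for y z
    unfolding D2_def by (rule D1_eq)
  moreover have "D1 (fun_rep \<phi> f) u = l" by (rule ext) (simp add: D1[OF uW] blinfun.bilinear_simps)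
  ultimately show ?thesis using f by blast
qed

text \<open>The induced-connection identity and the local formula both compute the third Hessian.
  After cancelling D^3f, their equality for arbitrary first and second derivatives at
  \<open>u\<close> separates into one equation for R and one for C.\<close>

lemma induced_symbols:
  assumes ind: "induced_connection M N N2" and \<phi>: "\<phi> \<in> M" and u: "u \<in> img_of \<phi>"
  shows R_symbol_induced: "R_symbol M N2 \<phi> u x (x \<Delta> x) =
      D1 (\<lambda>w. \<Gamma> \<phi> w x x) u x + \<Gamma> \<phi> u (\<Gamma> \<phi> u x x) x + \<Gamma> \<phi> u x (\<Gamma> \<phi> u x x)" (is "?R = ?R'")
    and C_symbol_induced: "C_symbol M N2 \<phi> u x (x \<Delta> x) = 3 *\<^sub>R (x \<Delta> \<Gamma> \<phi> u x x)" (is "?C = ?C'")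
proof -
  let ?g = "\<Gamma> \<phi> u x x"
  obtain W where W: "open W" "u \<in> W" "W \<subseteq> img_of \<phi>"
    and c: "\<And>x. \<exists>X\<in>vector_fields M. \<forall>w\<in>W. field_rep \<phi> X w = x"
    using constant_field_exists[OF \<phi> u] by blast
  obtain X where X: "X \<in> vector_fields M" "\<And>w. w \<in> W \<Longrightarrow> field_rep \<phi> X w = x" using c by metis
  define m where "m = inv_chart \<phi> u"
  have m: "m \<in> dom_of \<phi>" "map_of_chart \<phi> m = u"
    unfolding m_def by (simp_all add: inv_chart_dom map_inv_chart \<phi> u)
  have Xm: "X m \<phi> = x" using X(2)[OF W(2)] by (simp add: field_rep_def m_def)
  have eq: "Rep_sym_tensor ?C b + l ?R = Rep_sym_tensor ?C' b + l ?R'"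
    if l: "bounded_linear l" for l and b :: "'e \<Rightarrow>\<^sub>L 'e \<Rightarrow>\<^sub>L real"
  proof -
    obtain f where f: "f \<in> smooth_functions M" "D1 (fun_rep \<phi> f) u = l"
      "D2 (fun_rep \<phi> f) u = (\<lambda>y z. (b y z + b z y) / 2)"
      using polynomial_function_exists[OF \<phi> u l] by blast
    let ?F = "fun_rep \<phi> f"
    have "hess3 M N f X X X m = D3 ?F u x x x + sym_lift (D2 ?F u) ?C + D1 ?F u ?R"
      using ind f(1) X(1) \<phi> m Xm unfolding induced_connection_def Let_def by metis
    moreover have "hess3 M N f X X X m = D3 ?F u x x x +
        (D2 ?F u x ?g + D2 ?F u ?g x + D2 ?F u x ?g) + D1 ?F u ?R'"
      using hess3_constant_field[OF f(1) \<phi> W X] by (simp add: fun_rep_def m_def)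
    moreover have "Rep_sym_tensor ?C' b = 3 * ((b x ?g + b ?g x) / 2)"
      by (simp add: scaleR_sym_tensor.rep_eq sym_prod.rep_eq sym_eval_apply blinfun.bilinear_simps)
    ultimately show ?thesis by (simp only: f(2,3) sym_lift_blinfun[OF fin_dim]) argo
  qed
  obtain B :: "'e set" and r where co: "coordinates B r"
    using coordinates_exist[OF fin_dim] by blast
  \<comment> \<open>With \<open>b = 0\<close> only the first-order terms remain, and the coordinate
    functionals separate vectors.\<close>
  have "r v ?R = r v ?R'" for v
    using eq[OF coordinatesD(2)[OF co], of 0 v] by (simp add: blinfun.bilinear_simps)
  then have "(\<Sum>v\<in>B. r v ?R *\<^sub>R v) = (\<Sum>v\<in>B. r v ?R' *\<^sub>R v)" by (simp only:)
  then show "?R = ?R'" by (simp only: coordinatesD(3)[OF co])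
  show "?C = ?C'"
    \<comment> \<open>With the zero functional for \<open>l\<close> only the tensor terms remain,
      for every \<open>b\<close>.\<close>
    by (rule sym_tensor_eqI) (use eq[OF bounded_linear_zero] in simp)
qed

end

section \<open>Geodesics\<close>

text \<open>Evaluation on a form averages two values, each bounded by the product of norms, so the
  constant is 1. Boundedness makes the product rule applicable to the square of the
  velocity.\<close>

lemma bounded_bilinear_sym_prod: "bounded_bilinear ((\<Delta>) :: 'e::real_normed_vector \<Rightarrow> _)"
proof -
  note b = bilinear_sym_prod
  have "norm (y \<Delta> z) \<le> norm y * norm z * 1" for y z :: 'e
  proof -
    have "norm (blinfun_apply (sym_eval y z) b) \<le> norm y * norm z * norm b" for b :: "'e \<Rightarrow>\<^sub>L 'e \<Rightarrow>\<^sub>L real"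
    proof -
      have n: "\<bar>b v w\<bar> \<le> norm b * norm v * norm w" for v w
        using norm_blinfun[of "b v" w] mult_right_mono[OF norm_blinfun[of b v] norm_ge_zero[of w]]
        by (simp add: order_trans)
      show ?thesis using n[of y z] n[of z y] by (simp add: sym_eval_apply abs_le_iff algebra_simps)
    qed
    then have "norm (sym_eval y z) \<le> norm y * norm z"
      by (intro norm_blinfun_bound) auto
    then show ?thesis by (simp add: norm_sym_tensor.rep_eq sym_prod.rep_eq)
  qed
  then show ?thesis
    by (intro bounded_bilinear.intro exI[of _ 1] allI)
      (simp_all add: bilinear_ladd[OF b] bilinear_radd[OF b] bilinear_lmul[OF b] bilinear_rmul[OF b])
qed

lemma smooth_on_has_vector_derivative:
  "smooth_on J p \<Longrightarrow> t \<in> J \<Longrightarrow> (p has_vector_derivative vector_derivative p (at t)) (at t)"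
  using smooth_on_differentiable vector_derivative_works by blast

lemma smooth_on_vector_derivative:
  assumes "open J" "smooth_on J p"
  shows "smooth_on J (\<lambda>t. vector_derivative p (at t))"
proof (rule smooth_on_cong[OF assms(1) _ smooth_on_D1[OF assms(2)]])
  show "D1 p t 1 = vector_derivative p (at t)" if "t \<in> J" for t
    using smooth_on_has_vector_derivative[OF assms(2) that] D1_eq
    unfolding has_vector_derivative_def by force
qed

context manifold_connection
begin

text \<open>In coordinates the expression is a finite sum of two scalar factors from
  \<open>y\<close> and one factor depending on \<open>p\<close>. Bilinearity of \<Gamma> is known
  only over the chart image, hence the condition on \<open>p\<close>.\<close>

lemma christoffel_along:
  assumes \<phi>: "\<phi> \<in> M" and J: "open J" "t \<in> J" "p ` J \<subseteq> img_of \<phi>"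
    and p: "(p has_vector_derivative p') (at t)" and y: "(y has_vector_derivative y') (at t)"
  shows "((\<lambda>s. \<Gamma> \<phi> (p s) (y s) (y s)) has_vector_derivative
    D1 (\<lambda>w. \<Gamma> \<phi> w (y t) (y t)) (p t) p' + \<Gamma> \<phi> (p t) y' (y t) + \<Gamma> \<phi> (p t) (y t) y') (at t)"
proof -
  obtain B :: "'e set" and r where co: "coordinates B r"
    using coordinates_exist[OF fin_dim] by blast
  note r = coordinatesD(2)[OF co]
  let ?g = "\<lambda>b c w. \<Gamma> \<phi> w b c"
  have u: "p t \<in> img_of \<phi>" using J by blast
  have ex: "\<Gamma> \<phi> w x z = (\<Sum>b\<in>B. \<Sum>c\<in>B. (r b x * r c z) *\<^sub>R ?g b c w)"
    if "w \<in> img_of \<phi>" for w x z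
  proof -
    note bi = bilinear_christoffel[OF \<phi> that]
    have "\<Gamma> \<phi> w x z = (\<Sum>b\<in>B. r b x *\<^sub>R \<Gamma> \<phi> w b z)"
      by (rule linear_coordinates[OF co]) (use bi in \<open>simp add: bilinear_def\<close>)
    also have "\<dots> = (\<Sum>b\<in>B. r b x *\<^sub>R (\<Sum>c\<in>B. r c z *\<^sub>R \<Gamma> \<phi> w b c))"
      by (intro sum.cong refl arg_cong2[where f = scaleR] linear_coordinates[OF co])
        (use bi in \<open>simp add: bilinear_def\<close>)
    finally show ?thesis by (simp add: scaleR_sum_right)
  qed
  have g: "(?g b c has_derivative D1 (?g b c) (p t)) (at (p t))" for b c
    by (rule christoffel_has_derivative[OF \<phi> u])
  have "((\<lambda>w. \<Sum>b\<in>B. \<Sum>c\<in>B. (r b x * r c x) *\<^sub>R ?g b c w) has_derivative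
      (\<lambda>v. \<Sum>b\<in>B. \<Sum>c\<in>B. (r b x * r c x) *\<^sub>R D1 (?g b c) (p t) v)) (at (p t))" for x
    by (intro has_derivative_sum has_derivative_scaleR_right g)
  then have "((\<lambda>w. \<Gamma> \<phi> w x x) has_derivative
      (\<lambda>v. \<Sum>b\<in>B. \<Sum>c\<in>B. (r b x * r c x) *\<^sub>R D1 (?g b c) (p t) v)) (at (p t))" for x
    by (rule has_derivative_transform_within_open[OF _ open_img[OF \<phi>] u]) (simp add: ex[symmetric])
  \<comment> \<open>With the arguments of \<Gamma> frozen, this recognises the part of the product
    rule in which only the base point moves.\<close>
  then have D: "D1 (\<lambda>w. \<Gamma> \<phi> w x x) (p t) v =
      (\<Sum>b\<in>B. \<Sum>c\<in>B. (r b x * r c x) *\<^sub>R D1 (?g b c) (p t) v)" for x v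
    by (rule D1_eq)
  have p': "((\<lambda>s. ?g b c (p s)) has_derivative (\<lambda>h. D1 (?g b c) (p t) (h *\<^sub>R p'))) (at t)" for b c
    by (rule has_derivative_compose[where f = p and g = "?g b c"])
      (use p g in \<open>simp_all add: has_vector_derivative_def\<close>)
  have y': "((\<lambda>s. r b (y s)) has_derivative (\<lambda>h. r b (h *\<^sub>R y'))) (at t)" for b
    using y unfolding has_vector_derivative_def by (rule bounded_linear.has_derivative[OF r])
  have "((\<lambda>s. \<Sum>b\<in>B. \<Sum>c\<in>B. (r b (y s) * r c (y s)) *\<^sub>R ?g b c (p s)) has_derivative
      (\<lambda>h. \<Sum>b\<in>B. \<Sum>c\<in>B. (r b (y t) * r c (y t)) *\<^sub>R D1 (?g b c) (p t) (h *\<^sub>R p') +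
        (r b (y t) * r c (h *\<^sub>R y') + r b (h *\<^sub>R y') * r c (y t)) *\<^sub>R ?g b c (p t))) (at t)"
    by (intro has_derivative_sum has_derivative_scaleR has_derivative_mult p' y')
  also have "(\<lambda>h. \<Sum>b\<in>B. \<Sum>c\<in>B. (r b (y t) * r c (y t)) *\<^sub>R D1 (?g b c) (p t) (h *\<^sub>R p') +
        (r b (y t) * r c (h *\<^sub>R y') + r b (h *\<^sub>R y') * r c (y t)) *\<^sub>R ?g b c (p t)) =
      (\<lambda>h. h *\<^sub>R (D1 (\<lambda>w. \<Gamma> \<phi> w (y t) (y t)) (p t) p' + \<Gamma> \<phi> (p t) y' (y t) + \<Gamma> \<phi> (p t) (y t) y'))"
    unfolding D ex[OF u, of y' "y t"] ex[OF u, of "y t" y']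
    by (simp add: linear_scale[OF has_derivative_linear[OF g]]
        linear_scale[OF bounded_linear.linear[OF r]]
        scaleR_sum_right scaleR_add_left scaleR_add_right sum.distrib algebra_simps)
  finally have "((\<lambda>s. \<Gamma> \<phi> (p s) (y s) (y s)) has_derivative
      (\<lambda>h. h *\<^sub>R (D1 (\<lambda>w. \<Gamma> \<phi> w (y t) (y t)) (p t) p' + \<Gamma> \<phi> (p t) y' (y t) + \<Gamma> \<phi> (p t) (y t) y'))) (at t)"
    by (rule has_derivative_transform_within_open[OF _ J(1,2)])
      (use J(3) in \<open>simp add: ex[symmetric] image_subset_iff\<close>)
  then show ?thesis by (simp add: has_vector_derivative_def)
qed

end

theorem proposition6p1:
  fixes M :: "('m::t2_space, 'e::banach) chart set"
    and nabla :: "('m, 'e, 'e) connection"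
    and nabla2 :: "('m, 'e, 'e \<times> 'e sym_tensor) connection"
    and I :: "real set" and c :: "real \<Rightarrow> 'm"
  assumes "smooth_manifold M"
    and "koszul_connection M tangent nabla"
    and "special_second_order_connection M nabla2"
    and "induced_connection M nabla nabla2"
    and "geodesic M nabla I c"
  shows "second_order_geodesic M nabla2 I c"
proof -
  interpret manifold_connection M nabla using assms(1,2) by unfold_locales
  have curve: "smooth_curve M I c" using assms(5) by (simp add: geodesic_def)
  have "covariant_along M tangent2 nabla2 c (second_order_lift M c) t \<phi> = 0"
    if t: "t \<in> I" for t \<phi>
  \<comment> \<open>At indices other than charts around \<open>c t\<close> the covariant derivative
    is zero by convention.\<close>
  proof (cases "\<phi> \<in> M \<and> c t \<in> dom_of \<phi>")
    case True
    then have \<phi>: "\<phi> \<in> M" and ct: "c t \<in> dom_of \<phi>" by auto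
    define J where "J = {t\<in>I. c t \<in> dom_of \<phi>}"
    let ?p = "map_of_chart \<phi> \<circ> c" and ?v = "vel \<phi> c" and ?a = "acc \<phi> c"
    define u where "u = map_of_chart \<phi> (c t)"
    have u: "u \<in> img_of \<phi>" unfolding u_def by (rule map_img[OF ct])
    have "open (I \<inter> c -` dom_of \<phi>)"
      using curve open_dom[OF \<phi>] by (intro continuous_open_preimage) (auto simp: smooth_curve_def)
    also have "I \<inter> c -` dom_of \<phi> = J" by (auto simp: J_def)
    finally have J: "open J" .
    have tJ: "t \<in> J" using t ct by (simp add: J_def)
    have p: "smooth_on J ?p" using curve \<phi> by (simp add: smooth_curve_def J_def)
    have v: "smooth_on J ?v" using smooth_on_vector_derivative[OF J p] by (simp add: vel_def[abs_def])
    have p': "(?p has_vector_derivative ?v t) (at t)"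
      using smooth_on_has_vector_derivative[OF p tJ] by (simp add: vel_def)
    have v': "(?v has_vector_derivative ?a t) (at t)"
      using smooth_on_has_vector_derivative[OF v tJ] by (simp add: acc_def)
    \<comment> \<open>The geodesic equation is recorded on the open set \<open>J\<close>, not just
      at \<open>t\<close>, because it is about to be differentiated.\<close>
    have geo: "?a s = \<Gamma> \<phi> (?p s) (?v s) (?v s)" if "s \<in> J" for s
      using assms(5) \<phi> that by (simp add: geodesic_def J_def)
    have at: "?a t = \<Gamma> \<phi> u (?v t) (?v t)" using geo[OF tJ] by (simp add: u_def)
    have "?p ` J \<subseteq> img_of \<phi>" by (auto simp: J_def map_img)
    note along = christoffel_along[OF \<phi> J tJ this p' v']
    have "(?a has_vector_derivative D1 (\<lambda>w. \<Gamma> \<phi> w (?v t) (?v t)) u (?v t) +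
        \<Gamma> \<phi> u (?a t) (?v t) + \<Gamma> \<phi> u (?v t) (?a t)) (at t)"
      using has_vector_derivative_transform_within_open[OF along J tJ geo[symmetric]]
      by (simp add: u_def)
    then have a': "(?a has_vector_derivative R_symbol M nabla2 \<phi> u (?v t) (?v t \<Delta> ?v t)) (at t)"
      by (simp add: R_symbol_induced[OF assms(4) \<phi> u] at)
    have vv: "((\<lambda>s. ?v s \<Delta> ?v s) has_vector_derivative 2 *\<^sub>R (?v t \<Delta> ?a t)) (at t)"
      using bounded_bilinear.has_vector_derivative[OF bounded_bilinear_sym_prod v' v']
      by (simp add: sym_prod_commute[of "?a t"] scaleR_2)
    have "((\<lambda>s. second_order_lift M c s \<phi>) has_vector_derivative
        (R_symbol M nabla2 \<phi> u (?v t) (?v t \<Delta> ?v t), 2 *\<^sub>R (?v t \<Delta> ?a t))) (at t)"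
      by (rule has_vector_derivative_transform_within_open[OF has_vector_derivative_Pair[OF a' vv] J tJ])
        (use \<phi> in \<open>simp add: second_order_lift_def J_def\<close>)
    then have "vector_derivative (\<lambda>s. second_order_lift M c s \<phi>) (at t) =
        (R_symbol M nabla2 \<phi> u (?v t) (?v t \<Delta> ?v t), 2 *\<^sub>R (?v t \<Delta> ?a t))"
      by (rule vector_derivative_at)
    moreover have "christoffel M tangent2 nabla2 \<phi> u (?v t) (?a t, ?v t \<Delta> ?v t) =
        (R_symbol M nabla2 \<phi> u (?v t) (?v t \<Delta> ?v t),
          - (?v t \<Delta> ?a t) + C_symbol M nabla2 \<phi> u (?v t) (?v t \<Delta> ?v t))"
      using assms(3) \<phi> u unfolding special_second_order_connection_def by blast
    \<comment> \<open>Of the three copies in C, one cancels against the term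
      \<open>- (?v t \<Delta> ?a t)\<close> of the Christoffel symbol, and two against the
      derivative of the squared velocity.\<close>
    moreover have "3 *\<^sub>R (?v t \<Delta> ?a t) = ?v t \<Delta> ?a t + 2 *\<^sub>R (?v t \<Delta> ?a t)"
      using scaleR_add_left[of 1 2 "?v t \<Delta> ?a t"] by simp
    ultimately show ?thesis
      using \<phi> ct by (simp add: covariant_along_def second_order_lift_def u_def[symmetric]
          C_symbol_induced[OF assms(4) \<phi> u] at[symmetric] zero_prod_def)
  qed (auto simp: covariant_along_def)
  then show ?thesis using curve by (auto simp: second_order_geodesic_def)
qed

end
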